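(* Let $\beta_1\in\mathbb{R}$, $\beta_2>0$, and set $\theta_2=\tfrac14\beta_2$, $\theta_1=\tfrac12(\beta_1+\beta_2)$. Suppose $\theta=(\theta_1,\theta_2)\in\Theta_2$, i.e. $\theta_1=0$ and $\theta_2>1/2$. Then there exist distinct $p_1,p_2\in(0,1)$ for which, for every $\delta>0$ and for $j=1,2$, $$\Big|\mathbb{P}_{n,\beta}\Big(\max_{1\le i\le n}\Big|\frac{d_i}{n-1}-p_j\Big|>\delta\Big)-\frac12\Big|\le e^{-\Omega(n)}.$$
   Context: $\mathcal{X}_n$ is the set of simple graphs on $\{1,\dots,n\}$, identified with their adjacency matrices $x=(x_{ij})$ (symmetric, zero diagonal, $0/1$ off-diagonal entries). The two star model is the probability mass function on $\mathcal{X}_n$ $$\mathbb{P}_{n,\beta}(x)=\frac{1}{Z_n(\beta)}\exp\Big\{\frac{\beta_2}{n-1}T(x)+\Big(\beta_1+\frac{\beta_2}{n-1}\Big)E(x)\Big\},$$ with $T(x)=\sum_i\sum_{j<l;\,j,l\ne i}x_{ij}x_{il}$ (number of two stars), $E(x)=\sum_{i<j}x_{ij}$ (number of edges), and $Z_n(\beta)$ the normalizing constant. $d_i=d_i(x)=\sum_{j\ne i}x_{ij}$ is the degree of vertex $i$ in the random graph $x\sim\mathbb{P}_{n,\beta}$. The parameters $\beta_1,\beta_2$ are fixed and do not depend on $n$. For positive sequences, $a_n=\Omega(b_n)$ means that there is a constant $C>0$ free of $n$ with $a_n\ge C b_n$; thus a bound by $e^{-\Omega(n)}$ means a bound by $e^{-Cn}$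 for some constant $C>0$ not depending on $n$ (here $C$ may depend on $\delta$ and on the parameters).
   Formalization: "For every δ > 0" is proved for 0 < δ < |p1 − p2| only: for δ ≥ 1 the event is empty and the bound fails, and for δ > |p1 − p2| the probability tends to 0; the single value δ = |p1 − p2| is not claimed. *)

theory Defs
  imports "HOL-Probability.Probability"
begin

text \<open>Entries outside \<open>{1..n}\<close> are forced to be 0, so that every simple graph on
  \<open>{1..n}\<close> has exactly one adjacency matrix in \<open>graphs n\<close>.\<close>

definition graphs :: "nat \<Rightarrow> (nat \<Rightarrow> nat \<Rightarrow> nat) set" where
  "graphs n = {x. (\<forall>i j. x i j \<in> {0, 1}) \<and> (\<forall>i j. x i j = x j i) \<and> (\<forall>i. x i i = 0) \<and>
                  (\<forall>i j. i \<notin> {1..n} \<or> j \<notin> {1..n} \<longrightarrow> x i j = 0)}"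

definition num_two_stars :: "nat \<Rightarrow> (nat \<Rightarrow> nat \<Rightarrow> nat) \<Rightarrow> nat" where
  "num_two_stars n x =
     (\<Sum>i\<in>{1..n}. \<Sum>(j, l) \<in> {(j, l). j \<in> {1..n} - {i} \<and> l \<in> {1..n} - {i} \<and> j < l}. x i j * x i l)"

definition num_edges :: "nat \<Rightarrow> (nat \<Rightarrow> nat \<Rightarrow> nat) \<Rightarrow> nat" where
  "num_edges n x = (\<Sum>(i, j) \<in> {(i, j). i \<in> {1..n} \<and> j \<in> {1..n} \<and> i < j}. x i j)"

definition deg :: "nat \<Rightarrow> (nat \<Rightarrow> nat \<Rightarrow> nat) \<Rightarrow> nat \<Rightarrow> nat" where
  "deg n x i = (\<Sum>j \<in> {1..n} - {i}. x i j)"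

definition two_star_weight :: "nat \<Rightarrow> real \<Rightarrow> real \<Rightarrow> (nat \<Rightarrow> nat \<Rightarrow> nat) \<Rightarrow> real" where
  "two_star_weight n \<beta>1 \<beta>2 x =
     exp (\<beta>2 / (real n - 1) * real (num_two_stars n x)
          + (\<beta>1 + \<beta>2 / (real n - 1)) * real (num_edges n x))"

definition two_star_Z :: "nat \<Rightarrow> real \<Rightarrow> real \<Rightarrow> real" where
  "two_star_Z n \<beta>1 \<beta>2 = (\<Sum>x\<in>graphs n. two_star_weight n \<beta>1 \<beta>2 x)"

definition two_star_pmf :: "nat \<Rightarrow> real \<Rightarrow> real \<Rightarrow> (nat \<Rightarrow> nat \<Rightarrow> nat) pmf" where
  "two_star_pmf n \<beta>1 \<beta>2 =
     embed_pmf (\<lambda>x. if x \<in> graphs n then two_star_weight n \<beta>1 \<beta>2 x / two_star_Z n \<beta>1 \<beta>2 else 0)"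

definition Theta2 :: "(real \<times> real) set" where
  "Theta2 = {(\<theta>1, \<theta>2). \<theta>1 = 0 \<and> \<theta>2 > 1 / 2}"

lemma finite_graphs: "finite (graphs n)"
proof (rule finite_subset)
  let ?f = "\<lambda>A::(nat \<times> nat) set. \<lambda>i j. if (i, j) \<in> A then 1 else 0 :: nat"
  show "graphs n \<subseteq> ?f ` Pow ({1..n} \<times> {1..n})"
  proof
    fix x assume x: "x \<in> graphs n"
    have v: "x i j = 0 \<or> x i j = 1" for i j
      using x unfolding graphs_def by blast
    have z: "x i j = 0" if "i \<notin> {1..n} \<or> j \<notin> {1..n}" for i j
      using x that unfolding graphs_def by blast
    have "x = ?f {(i, j). x i j = 1}"
      using v by (fastforce simp: fun_eq_iff)
    moreover have "{(i, j). x i j = 1} \<in> Pow ({1..n} \<times> {1..n})"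
    proof (rule PowI, rule subsetI)
      fix e assume "e \<in> {(i, j). x i j = 1}"
      then show "e \<in> {1..n} \<times> {1..n}"
        using z[of "fst e" "snd e"] by (cases e) (auto simp: not_le intro: ccontr)
    qed
    ultimately show "x \<in> ?f ` Pow ({1..n} \<times> {1..n})"
      by blast
  qed
qed simp

lemma two_star_Z_pos: "two_star_Z n \<beta>1 \<beta>2 > 0"
proof -
  have "(\<lambda>i j. 0) \<in> graphs n"
    by (simp add: graphs_def)
  then show ?thesis
    unfolding two_star_Z_def two_star_weight_def
    by (intro sum_pos) (auto simp: finite_graphs)
qed

text \<open>The argument of \<open>embed_pmf\<close> is indeed a probability mass function.\<close>

lemma pmf_two_star_pmf:
  "pmf (two_star_pmf n \<beta>1 \<beta>2) x =
     (if x \<in> graphs n then two_star_weight n \<beta>1 \<beta>2 x / two_star_Z n \<beta>1 \<beta>2 else 0)"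
proof -
  let ?p = "\<lambda>x. if x \<in> graphs n then two_star_weight n \<beta>1 \<beta>2 x / two_star_Z n \<beta>1 \<beta>2 else 0"
  have nonneg: "0 \<le> ?p x" for x
    using two_star_Z_pos[of n \<beta>1 \<beta>2] by (simp add: two_star_weight_def)
  have "(\<integral>\<^sup>+x. ennreal (?p x) \<partial>count_space UNIV) = (\<Sum>x\<in>graphs n. ennreal (?p x))"
    by (rule nn_integral_count_space'[OF finite_graphs]) auto
  also have "\<dots> = ennreal (\<Sum>x\<in>graphs n. ?p x)"
    using nonneg by (rule sum_ennreal)
  also have "(\<Sum>x\<in>graphs n. ?p x) = 1"
    using two_star_Z_pos[of n \<beta>1 \<beta>2]
    by (simp add: two_star_Z_def flip: sum_divide_distrib)
  finally have "(\<integral>\<^sup>+x. ennreal (?p x) \<partial>count_space UNIV) = 1"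
    by simp
  then show ?thesis
    unfolding two_star_pmf_def by (intro pmf_embed_pmf nonneg)
qed

end

theory Submission
  imports Defs "HOL-Real_Asymp.Real_Asymp"
begin

text \<open>
  Replace the entries \<open>x\<^sub>i\<^sub>j\<close> of the adjacency matrix by spins \<open>y\<^sub>i\<^sub>j = 2 x\<^sub>i\<^sub>j - 1\<close>, put \<open>M = n - 1\<close>, and
  let \<open>k\<^sub>i\<close> be the sum of the spins at vertex \<open>i\<close>. For \<open>\<theta>1 = 0\<close> the linear term cancels and the
  weight of a graph becomes a constant times \<open>exp (\<theta> / (2 M) * (\<Sum>i. k\<^sub>i\<^sup>2))\<close> with \<open>\<theta> = \<theta>2\<close>
  (\<open>two_star_weight_adjacency\<close>). This is invariant under \<open>y \<mapsto> -y\<close>, that is, under complementing the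
  graph.

  Everything is governed by the pair energy
  \<open>\<theta> / 2 * (s\<^sup>2 + t\<^sup>2) - ln (cosh (\<theta> * (s + t))) = \<theta> / 4 * (s - t)\<^sup>2 + q ((s + t) / 2)\<close>, where
  \<open>q u = \<theta> * u\<^sup>2 - ln (cosh (2 * \<theta> * u))\<close>. For \<open>\<theta> > 1/2\<close> the function \<open>q\<close> attains its minimum
  exactly at two points \<open>m\<close> and \<open>-m\<close>, so the pair energy is minimal exactly when
  \<open>s = t \<in> {m, -m}\<close>. These are the two phases; in terms of edge densities they are
  \<open>p = (1 + m) / 2\<close> and \<open>p = (1 - m) / 2\<close>.

  A graph has all scaled degrees \<open>t\<^sub>i = k\<^sub>i / M\<close> close to one phase, up to exponentially small
  probability, for two reasons.

  \<^item> Tilting the edges independently by \<open>\<theta> * (t\<^sub>i + t\<^sub>j)\<close> shows that the graphs with degree sequence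
    \<open>t\<close> have probability at most the exponential of minus the sum over edges of the excess of the
    pair energy over its minimum; a matching lower bound for the partition function comes from
    \<open>k\<^sup>2 \<ge> 2 k M m - M\<^sup>2 m\<^sup>2\<close> (\<open>degree_sequence_weight\<close>). There are only \<open>n\<^sup>n\<close> degree sequences, which
    is negligible against \<open>exp (- c n\<^sup>2)\<close>. Hence the excess is small, and then the mean distance of
    the \<open>t\<^sub>i\<close> to one of the phases is small (\<open>near_phase_of_small_excess\<close>).
  \<^item> This does not rule out single deviating vertices, whose cost is only exponential in \<open>n\<close>. Given
    the edges not touching \<open>i\<close>, however, the edges at \<open>i\<close> form a Curie-Weiss model. Its external
    fields are the scaled degrees of the other vertices, \<open>i\<close> left out, and these are on average
    close to a phase \<open>p\<close>. The same tilting argument, now with only \<open>n\<close> possible values of \<open>k\<^sub>i\<close>,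
    gives a deviation of \<open>t\<^sub>i\<close> from \<open>p\<close> an exponentially small probability
    (\<open>curie_weiss_deviation\<close>, \<open>vertex_deviation\<close>), and a union bound over \<open>i\<close> finishes the argument
    (\<open>no_phase_weight\<close>).

  By the complementation symmetry both phases have the same probability, so each has probability
  \<open>1/2\<close> up to half that of the graphs in neither phase (\<open>two_phase_probability\<close>).
\<close>

section \<open>The energy of a pair of vertices\<close>

definition pair_energy :: "real \<Rightarrow> real \<Rightarrow> real \<Rightarrow> real" where
  "pair_energy \<theta> s t = \<theta> / 2 * (s\<^sup>2 + t\<^sup>2) - ln (cosh (\<theta> * (s + t)))"

text \<open>The two parts of the energy are a penalty for disagreement between the two vertices and the
  energy of their mean. Lower bounds on the energy are thereby reduced to the diagonal.\<close>

lemma pair_energy_decomp: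
  "pair_energy \<theta> s t = \<theta> / 4 * (s - t)\<^sup>2 + pair_energy \<theta> ((s + t) / 2) ((s + t) / 2)"
proof -
  have "\<theta> * ((s + t) / 2 + (s + t) / 2) = \<theta> * (s + t)" by simp
  then show ?thesis
    unfolding pair_energy_def by (simp only:) (simp add: field_simps power2_eq_square)
qed

lemma pair_energy_minus: "pair_energy \<theta> (- s) (- t) = pair_energy \<theta> s t"
proof -
  have "\<theta> * (- s + - t) = - (\<theta> * (s + t))" by (simp add: algebra_simps)
  then show ?thesis by (simp only: pair_energy_def cosh_minus power2_minus)
qed

lemma pair_energy_commute: "pair_energy \<theta> s t = pair_energy \<theta> t s"
  unfolding pair_energy_def by (simp add: add.commute)

lemma continuous_on_pair_energy [continuous_intros]:
  assumes "continuous_on A f" "continuous_on A g"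
  shows "continuous_on A (\<lambda>x. pair_energy \<theta> (f x) (g x))"
  unfolding pair_energy_def
  by (intro continuous_intros assms) (auto simp: cosh_real_pos less_imp_neq[THEN not_sym])

text \<open>The derivative of \<open>ln \<circ> cosh\<close> is \<open>tanh\<close>, which is bounded by 1; the direct proof compares
  both exponentials in \<open>cosh\<close>.\<close>

lemma ln_cosh_diff_le: "ln (cosh x) - ln (cosh y) \<le> \<bar>x - y\<bar>" for x y :: real
proof -
  have "exp x \<le> exp \<bar>x - y\<bar> * exp y" "exp (- x) \<le> exp \<bar>x - y\<bar> * exp (- y)"
    by (simp_all flip: exp_add)
  then have "cosh x \<le> exp \<bar>x - y\<bar> * cosh y"
    by (simp add: cosh_field_def algebra_simps)
  then have "ln (cosh x) \<le> ln (exp \<bar>x - y\<bar> * cosh y)"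
    by (subst ln_le_cancel_iff) (auto simp: cosh_real_pos)
  then show ?thesis by (simp add: ln_mult cosh_real_pos)
qed

text \<open>The mean-field equation. On the positive axis \<open>u - tanh (2 * \<theta> * u)\<close> is strictly convex,
  vanishes at the origin with slope \<open>1 - 2 * \<theta> < 0\<close>, and is positive from \<open>u = 1\<close> on. It
  therefore has exactly one positive zero and changes its sign there.\<close>

lemma tanh_fixed_point:
  fixes \<theta> :: real
  assumes "\<theta> > 1 / 2"
  obtains m where "0 < m" "m < 1"
    "\<And>u. 0 < u \<Longrightarrow> u < m \<Longrightarrow> u < tanh (2 * \<theta> * u)"
    "\<And>u. m < u \<Longrightarrow> tanh (2 * \<theta> * u) < u"
proof -
  define g where "g u = u - tanh (2 * \<theta> * u)" for u
  define g' where "g' u = 1 - (1 - (tanh (2 * \<theta> * u))\<^sup>2) * (2 * \<theta>)" for u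
  have \<theta>: "\<theta> > 0" using assms by simp
  have der: "(g has_real_derivative g' u) (at u)" for u
    unfolding g_def g'_def by (auto intro!: derivative_eq_intros simp: cosh_real_nonzero)
  have cont: "continuous_on A g" for A
    using der by (meson DERIV_continuous continuous_at_imp_continuous_on)
  have g0: "g 0 = 0" by (simp add: g_def)
  have big: "g u > 0" if "u \<ge> 1" for u
    using tanh_real_lt_1[of "2 * \<theta> * u"] that by (simp add: g_def)
  have g'_less: "g' u < g' v" if "0 < u" "u < v" for u v
  proof -
    have "0 < tanh (2 * \<theta> * u)" using that \<theta> by simp
    moreover have "tanh (2 * \<theta> * u) < tanh (2 * \<theta> * v)" using that \<theta> by simp
    ultimately have "(tanh (2 * \<theta> * u))\<^sup>2 < (tanh (2 * \<theta> * v))\<^sup>2"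
      by (intro power_strict_mono) auto
    then show ?thesis using \<theta> by (simp add: g'_def)
  qed
  \<comment> \<open>Two zeros on the positive axis would give, with the zero at the origin, two critical points of
      \<open>g\<close>, against the strict monotonicity of \<open>g'\<close>.\<close>
  have unique: False if ab: "0 < a" "a < b" "g a = 0" "g b = 0" for a b
  proof -
    have rolle: "\<exists>z. a < z \<and> z < b \<and> g' z = 0" if "a < b" "g a = g b" for a b
      using Rolle_deriv[of a b g "\<lambda>x v. v * g' x"] that cont der
      by (metis has_field_derivative_def mult_1 mult_commute_abs)
    obtain z1 where z1: "0 < z1" "z1 < a" "g' z1 = 0" using rolle[of 0 a] ab g0 by auto
    obtain z2 where z2: "a < z2" "z2 < b" "g' z2 = 0" using rolle[of a b] ab by auto
    show False using g'_less[of z1 z2] z1 z2 by simp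
  qed
  have zero: "\<exists>z\<ge>a. z \<le> b \<and> g z = 0" if "a \<le> b" "g a \<le> 0 \<and> 0 \<le> g b \<or> g b \<le> 0 \<and> 0 \<le> g a" for a b
    using that IVT'[of g a 0 b] IVT2'[of g b 0 a] cont by blast
  have "g' 0 < 0" using assms by (simp add: g'_def)
  from DERIV_neg_dec_right[OF der this]
  obtain d where d: "d > 0" "\<And>h. 0 < h \<Longrightarrow> h < d \<Longrightarrow> g h < 0" using g0 by auto
  define e where "e = min d 1 / 2"
  have e: "0 < e" "e < 1" "e < d" "g e < 0" using d by (auto simp: e_def)
  obtain m where m: "e \<le> m" "m \<le> 1" "g m = 0" using zero[of e 1] e big[of 1] by auto
  have m1: "m < 1" using m big[of m] by (cases "m = 1") auto
  show ?thesis
  proof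
    show "0 < m" "m < 1" using m m1 e by auto
  next
    fix u assume u: "0 < u" "u < m"
    have "g u < 0"
    proof (rule ccontr)
      assume "\<not> g u < 0"
      define v where "v = min d u / 2"
      have v: "0 < v" "v < u" "g v < 0" using d u by (auto simp: v_def)
      obtain z where "v \<le> z" "z \<le> u" "g z = 0" using zero[of v u] v \<open>\<not> g u < 0\<close> by auto
      then show False using unique[of z m] v u m by auto
    qed
    then show "u < tanh (2 * \<theta> * u)" by (simp add: g_def)
  next
    fix u assume u: "m < u"
    have "g u > 0"
    proof (rule ccontr)
      assume neg: "\<not> g u > 0"
      then have "u < 1" using big[of u] by force
      then obtain z where "u \<le> z" "z \<le> 1" "g z = 0" using zero[of u 1] neg big[of 1] by auto
      then show False using unique[of m z] m e u by auto
    qed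
    then show "tanh (2 * \<theta> * u) < u" by (simp add: g_def)
  qed
qed

text \<open>The derivative of the diagonal energy is \<open>2 * \<theta> * (u - tanh (2 * \<theta> * u))\<close>, so on the positive
  axis the energy decreases up to the fixed point \<open>m\<close> and increases afterwards; the negative axis
  follows as the energy is even.\<close>

lemma diagonal_energy_minimum:
  fixes \<theta> :: real
  assumes "\<theta> > 1 / 2"
  obtains m where "0 < m" "m < 1"
    "\<And>u. u \<noteq> m \<Longrightarrow> u \<noteq> - m \<Longrightarrow> pair_energy \<theta> m m < pair_energy \<theta> u u"
proof -
  define q where "q u = pair_energy \<theta> u u" for u
  have q: "q u = \<theta> * u\<^sup>2 - ln (cosh (\<theta> * (2 * u)))" for u by (simp add: q_def pair_energy_def)
  have der: "(q has_real_derivative 2 * \<theta> * (u - tanh (2 * \<theta> * u))) (at u)" for u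
    unfolding q by (auto intro!: derivative_eq_intros simp: cosh_real_pos tanh_def field_simps cosh_real_nonzero)
  have cont: "continuous_on A q" for A
    using der by (meson DERIV_continuous continuous_at_imp_continuous_on)
  obtain m where m: "0 < m" "m < 1"
    and below: "\<And>u. 0 < u \<Longrightarrow> u < m \<Longrightarrow> u < tanh (2 * \<theta> * u)"
    and above: "\<And>u. m < u \<Longrightarrow> tanh (2 * \<theta> * u) < u"
    using tanh_fixed_point[OF assms] by metis
  have pos: "q m < q u" if "0 \<le> u" "u \<noteq> m" for u
  proof (cases "u < m")
    case True
    show ?thesis
    proof (rule DERIV_neg_imp_decreasing_open[OF True _ cont])
      fix x assume "u < x" "x < m"
      then have "2 * \<theta> * (x - tanh (2 * \<theta> * x)) < 0"
        using below[of x] that assms by (simp add: mult_pos_neg)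
      then show "\<exists>y. (q has_real_derivative y) (at x) \<and> y < 0" using der by blast
    qed
  next
    case False
    then have *: "m < u" using that by simp
    show ?thesis
    proof (rule DERIV_pos_imp_increasing_open[OF * _ cont])
      fix x assume "m < x" "x < u"
      then have "2 * \<theta> * (x - tanh (2 * \<theta> * x)) > 0"
        using above[of x] assms by simp
      then show "\<exists>y. (q has_real_derivative y) (at x) \<and> y > 0" using der by blast
    qed
  qed
  show ?thesis
  proof
    show "0 < m" "m < 1" by fact+
    fix u assume "u \<noteq> m" "u \<noteq> - m"
    then have "q m < q \<bar>u\<bar>" using pos[of "\<bar>u\<bar>"] by auto
    also have "q \<bar>u\<bar> = q u" unfolding q_def
      using pair_energy_minus[of \<theta> u u] by (cases "u \<ge> 0") auto
    finally show "pair_energy \<theta> m m < pair_energy \<theta> u u" by (simp add: q_def)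
  qed
qed

lemma pair_excess_lower_bound:
  assumes "\<And>u. pair_energy \<theta> m m \<le> pair_energy \<theta> u u"
  shows "\<theta> / 4 * (s - t)\<^sup>2 \<le> pair_energy \<theta> s t - pair_energy \<theta> m m"
  using pair_energy_decomp[of \<theta> s t] assms[of "(s + t) / 2"] by simp

text \<open>The excess energy vanishes only if both arguments equal \<open>m\<close> or both equal \<open>- m\<close>. By compactness
  it is bounded away from 0 on the pairs \<open>(s, t)\<close> with \<open>t\<close> on one side of the origin and \<open>s\<close> away
  from the phase of that side. The phase is chosen by the sign of \<open>t\<close> alone, so that one vertex can
  later select the phase for all others; the additive \<open>\<epsilon>\<close> makes the bound linear in the excess.\<close>

lemma phase_distance_le_pair_excess:
  fixes \<theta> m \<epsilon> :: real
  assumes "\<theta> > 0" "0 < m" "m < 1"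
    and min: "\<And>u. u \<noteq> m \<Longrightarrow> u \<noteq> - m \<Longrightarrow> pair_energy \<theta> m m < pair_energy \<theta> u u"
    and "\<epsilon> > 0"
  obtains K where "K > 0"
    "\<And>s t. \<bar>s\<bar> \<le> 1 \<Longrightarrow> \<bar>t\<bar> \<le> 1 \<Longrightarrow>
       \<bar>s - (if t \<ge> 0 then m else - m)\<bar> \<le> \<epsilon> + K * (pair_energy \<theta> s t - pair_energy \<theta> m m)"
proof -
  have le: "pair_energy \<theta> m m \<le> pair_energy \<theta> u u" for u
    using min[of u] pair_energy_minus[of \<theta> m m] by (cases "u = m \<or> u = - m") auto
  define D where "D = (\<lambda>p. pair_energy \<theta> (fst p) (snd p) - pair_energy \<theta> m m)"
  have contD: "continuous_on A D" for A unfolding D_def by (intro continuous_intros)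
  have D0: "0 \<le> D p" for p
    using pair_excess_lower_bound[OF le, of "fst p" "snd p"] assms(1)
    unfolding D_def by (smt (verit) divide_nonneg_nonneg mult_nonneg_nonneg zero_le_power2)
  define B :: "(real \<times> real) set" where "B = ({-1..1} \<times> {0..1}) \<inter> {p. \<epsilon> \<le> \<bar>fst p - m\<bar>}"
  have "compact B" unfolding B_def
    by (intro compact_Int_closed compact_Times closed_Collect_le continuous_intros) auto
  have pos: "0 < D p" if "p \<in> B" for p
  proof -
    obtain s t where p: "p = (s, t)" by (cases p)
    have "D p \<noteq> 0"
    proof
      assume "D p = 0"
      then have z: "pair_energy \<theta> s t - pair_energy \<theta> m m = 0" by (simp add: D_def p)
      have "\<theta> / 4 * (s - t)\<^sup>2 \<le> 0" using pair_excess_lower_bound[OF le, of s t] z by simp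
      then have "(s - t)\<^sup>2 \<le> 0" using assms(1) by (simp add: mult_le_0_iff)
      then have "s = t" by simp
      then have "s = m \<or> s = - m" using min[of s] z by force
      then show False using that \<open>s = t\<close> assms by (auto simp: B_def p)
    qed
    then show ?thesis using D0[of p] by simp
  qed
  obtain \<eta> where \<eta>: "\<eta> > 0" "\<And>p. p \<in> B \<Longrightarrow> \<eta> \<le> D p"
  proof (cases "B = {}")
    case True then show ?thesis using that[of 1] by simp
  next
    case False
    then obtain p where "p \<in> B" "\<forall>q\<in>B. D p \<le> D q"
      using continuous_attains_inf[OF \<open>compact B\<close> _ contD] by blast
    then show ?thesis using that[of "D p"] pos by blast
  qed
  have nonneg: "\<bar>s - m\<bar> \<le> \<epsilon> + 2 / \<eta> * (pair_energy \<theta> s t - pair_energy \<theta> m m)"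
    if "\<bar>s\<bar> \<le> 1" "0 \<le> t" "t \<le> 1" for s t
  proof (cases "\<epsilon> \<le> \<bar>s - m\<bar>")
    case True
    then have "\<eta> \<le> D (s, t)" using that by (intro \<eta>) (auto simp: B_def)
    then have "2 \<le> 2 / \<eta> * D (s, t)" using \<eta>(1) by (simp add: field_simps)
    moreover have "\<bar>s - m\<bar> \<le> 2" using that assms by linarith
    ultimately show ?thesis using assms by (simp add: D_def)
  next
    case False
    moreover have "0 \<le> 2 / \<eta> * D (s, t)" using \<eta> D0 by simp
    ultimately show ?thesis by (simp add: D_def)
  qed
  show ?thesis
  proof
    show "2 / \<eta> > 0" using \<eta> by simp
    fix s t :: real assume "\<bar>s\<bar> \<le> 1" "\<bar>t\<bar> \<le> 1"
    then show "\<bar>s - (if t \<ge> 0 then m else - m)\<bar>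
        \<le> \<epsilon> + 2 / \<eta> * (pair_energy \<theta> s t - pair_energy \<theta> m m)"
      using nonneg[of s t] nonneg[of "- s" "- t"] pair_energy_minus[of \<theta> s t]
      by (cases "t \<ge> 0") (auto simp: abs_minus_commute)
  qed
qed

section \<open>Independent spins and the Curie-Weiss model\<close>

definition spin :: "'a set \<Rightarrow> 'a \<Rightarrow> real" where
  "spin S e = (if e \<in> S then 1 else - 1)"

lemma abs_spin [simp]: "\<bar>spin S e\<bar> = 1"
  by (simp add: spin_def)

lemma spin_squared [simp]: "(spin S e)\<^sup>2 = 1"
  by (simp add: spin_def)

lemma sum_spin: "finite A \<Longrightarrow> (\<Sum>e\<in>A. spin S e) = 2 * real (card (A \<inter> S)) - real (card A)"
  by (induction A rule: finite_induct) (auto simp: spin_def)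

text \<open>The partition function of independent spins with fields \<open>a\<close>.\<close>

lemma sum_exp_spin:
  fixes a :: "'a \<Rightarrow> real"
  assumes "finite A"
  shows "(\<Sum>S\<in>Pow A. exp (\<Sum>e\<in>A. spin S e * a e)) = (\<Prod>e\<in>A. 2 * cosh (a e))"
proof -
  have "(\<Prod>e\<in>A. 2 * cosh (a e)) = (\<Prod>e\<in>A. exp (a e) + exp (- a e))"
    by (simp add: cosh_field_def add_divide_distrib)
  also have "\<dots> = (\<Sum>S\<in>Pow A. (\<Prod>e\<in>S. exp (a e)) * (\<Prod>e\<in>A - S. exp (- a e)))"
    by (rule prod_add[OF assms])
  also have "\<dots> = (\<Sum>S\<in>Pow A. exp (\<Sum>e\<in>A. spin S e * a e))"
  proof (rule sum.cong[OF refl])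
    fix S assume "S \<in> Pow A"
    then have S: "S \<subseteq> A" by simp
    then have "finite S" using assms finite_subset by blast
    have "(\<Sum>e\<in>A. spin S e * a e) = (\<Sum>e\<in>A - S. spin S e * a e) + (\<Sum>e\<in>S. spin S e * a e)"
      by (rule sum.subset_diff[OF S assms])
    also have "\<dots> = (\<Sum>e\<in>A - S. - a e) + (\<Sum>e\<in>S. a e)"
      by (simp add: spin_def)
    finally show "(\<Prod>e\<in>S. exp (a e)) * (\<Prod>e\<in>A - S. exp (- a e)) = exp (\<Sum>e\<in>A. spin S e * a e)"
      using assms \<open>finite S\<close> by (simp add: exp_sum exp_add)
  qed
  finally show ?thesis by simp
qed

text \<open>The tangent of the convex function \<open>k\<^sup>2\<close> at \<open>k = M * m\<close>. It turns quadratic weights into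
  linear ones, whose sums factorize, and is an equality at \<open>k = M * m\<close>.\<close>

lemma exp_square_tangent:
  fixes \<theta> M k m :: real
  assumes "\<theta> > 0" "M > 0"
  shows "exp (\<theta> * m * k - \<theta> * M * m\<^sup>2 / 2) \<le> exp (\<theta> / (2 * M) * k\<^sup>2)"
proof -
  have "0 \<le> \<theta> / (2 * M) * (k - M * m)\<^sup>2" using assms by simp
  also have "\<dots> = \<theta> / (2 * M) * k\<^sup>2 - (\<theta> * m * k - \<theta> * M * m\<^sup>2 / 2)"
    using assms by (simp add: field_simps power2_eq_square)
  finally show ?thesis by simp
qed

text \<open>Linearizing the square at total spin \<open>M * m\<close> with \<open>exp_square_tangent\<close> bounds the sum of all
  weights from below by a multiple of the partition function of independent spins with fields
  \<open>\<theta> * (m + s\<^sub>j)\<close>. Linearizing at \<open>M * t\<close> instead is exact on the configurations with total spin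
  \<open>M * t\<close>. If all \<open>s\<^sub>j\<close> were equal to \<open>m\<close>, the ratio of the two linearized sums would be
  \<open>exp (- M * D)\<close>, with \<open>D\<close> the excess energy of the pair \<open>(t, m)\<close>; the Lipschitz bound
  \<open>ln_cosh_diff_le\<close> controls the error otherwise. The factor \<open>M + 1\<close> counts the values of the
  total spin.\<close>

lemma curie_weiss_deviation:
  fixes \<theta> m \<delta> :: real and s :: "'a \<Rightarrow> real"
  assumes "finite J" "J \<noteq> {}" and \<theta>: "\<theta> > 0"
    and min: "\<And>u. pair_energy \<theta> m m \<le> pair_energy \<theta> u u"
    and "\<delta> > 0"
  defines "M \<equiv> real (card J)"
  defines "w \<equiv> \<lambda>R. exp (\<theta> / (2 * M) * (\<Sum>j\<in>J. spin R j)\<^sup>2 + \<theta> * (\<Sum>j\<in>J. spin R j * s j))"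
  shows "(\<Sum>R | R \<in> Pow J \<and> \<bar>(\<Sum>j\<in>J. spin R j) / M - m\<bar> > \<delta>. w R)
     \<le> (M + 1) * exp (2 * \<theta> * (\<Sum>j\<in>J. \<bar>s j - m\<bar>) - M * \<theta> * \<delta>\<^sup>2 / 4) * (\<Sum>R\<in>Pow J. w R)"
proof -
  define k where "k R = (\<Sum>j\<in>J. spin R j)" for R
  \<comment> \<open>\<open>F t\<close> is the sum of the weights linearized at total spin \<open>M * t\<close>.\<close>
  define F where "F t = exp (- \<theta> * M * t\<^sup>2 / 2) * (\<Prod>j\<in>J. 2 * cosh (\<theta> * (t + s j)))" for t
  define \<rho> where "\<rho> = exp (2 * \<theta> * (\<Sum>j\<in>J. \<bar>s j - m\<bar>) - M * \<theta> * \<delta>\<^sup>2 / 4)"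
  have M: "M > 0" using assms by (simp add: M_def card_gt_0_iff)
  have F: "F t = (\<Sum>R\<in>Pow J. exp (\<theta> * t * k R - \<theta> * M * t\<^sup>2 / 2 + \<theta> * (\<Sum>j\<in>J. spin R j * s j)))" for t
  proof -
    have "(\<Prod>j\<in>J. 2 * cosh (\<theta> * (t + s j))) = (\<Sum>R\<in>Pow J. exp (\<Sum>j\<in>J. spin R j * (\<theta> * (t + s j))))"
      by (rule sum_exp_spin[OF \<open>finite J\<close>, symmetric])
    also have "\<dots> = (\<Sum>R\<in>Pow J. exp (\<theta> * t * k R + \<theta> * (\<Sum>j\<in>J. spin R j * s j)))"
      by (simp add: k_def sum_distrib_left sum.distrib algebra_simps)
    finally show ?thesis
      unfolding F_def by (simp only: sum_distrib_left flip: exp_add) (simp add: algebra_simps)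
  qed
  have F_le: "F m \<le> (\<Sum>R\<in>Pow J. w R)"
    unfolding F w_def k_def exp_add[of _ "\<theta> * (\<Sum>j\<in>J. _ j)"]
    by (intro sum_mono mult_right_mono exp_square_tangent \<theta> M) auto
  have ratio: "F t \<le> \<rho> * F m" if "\<bar>t - m\<bar> > \<delta>" for t
  proof -
    define D where "D = pair_energy \<theta> t m - pair_energy \<theta> m m"
    have F_exp: "F u = 2 ^ card J * exp (\<Sum>j\<in>J. ln (cosh (\<theta> * (u + s j))) - \<theta> * u\<^sup>2 / 2)" for u
    proof -
      have "(\<Prod>j\<in>J. 2 * cosh (\<theta> * (u + s j))) = 2 ^ card J * exp (\<Sum>j\<in>J. ln (cosh (\<theta> * (u + s j))))"
        using \<open>finite J\<close> by (simp add: prod.distrib exp_sum cosh_real_pos)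
      then show ?thesis
        unfolding F_def by (simp add: sum_subtractf M_def mult_ac flip: exp_add)
    qed
    have "\<delta>\<^sup>2 \<le> \<bar>t - m\<bar>\<^sup>2" using that \<open>\<delta> > 0\<close> by (intro power_mono) auto
    then have "\<theta> / 4 * \<delta>\<^sup>2 \<le> \<theta> / 4 * (t - m)\<^sup>2" using \<theta> by simp
    also have "\<dots> \<le> D" unfolding D_def by (rule pair_excess_lower_bound[OF min])
    finally have D: "\<theta> / 4 * \<delta>\<^sup>2 \<le> D" .
    have "(\<Sum>j\<in>J. ln (cosh (\<theta> * (t + s j))) - \<theta> * t\<^sup>2 / 2)
        \<le> (\<Sum>j\<in>J. 2 * \<theta> * \<bar>s j - m\<bar> - \<theta> / 4 * \<delta>\<^sup>2 + (ln (cosh (\<theta> * (m + s j))) - \<theta> * m\<^sup>2 / 2))"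
    proof (rule sum_mono)
      fix j
      have "ln (cosh (\<theta> * (t + s j))) - ln (cosh (\<theta> * (t + m))) \<le> \<bar>\<theta> * (t + s j) - \<theta> * (t + m)\<bar>"
        "ln (cosh (\<theta> * (m + m))) - ln (cosh (\<theta> * (m + s j))) \<le> \<bar>\<theta> * (m + m) - \<theta> * (m + s j)\<bar>"
        by (rule ln_cosh_diff_le)+
      moreover have "\<bar>\<theta> * (t + s j) - \<theta> * (t + m)\<bar> = \<theta> * \<bar>s j - m\<bar>"
        "\<bar>\<theta> * (m + m) - \<theta> * (m + s j)\<bar> = \<theta> * \<bar>s j - m\<bar>"
        using \<theta> by (simp_all add: abs_mult flip: right_diff_distrib)
      ultimately show "ln (cosh (\<theta> * (t + s j))) - \<theta> * t\<^sup>2 / 2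
          \<le> 2 * \<theta> * \<bar>s j - m\<bar> - \<theta> / 4 * \<delta>\<^sup>2 + (ln (cosh (\<theta> * (m + s j))) - \<theta> * m\<^sup>2 / 2)"
        using D unfolding D_def pair_energy_def by (simp add: algebra_simps)
    qed
    also have "\<dots> = 2 * \<theta> * (\<Sum>j\<in>J. \<bar>s j - m\<bar>) - M * \<theta> * \<delta>\<^sup>2 / 4
        + (\<Sum>j\<in>J. ln (cosh (\<theta> * (m + s j))) - \<theta> * m\<^sup>2 / 2)"
      by (simp add: sum.distrib sum_subtractf sum_distrib_left M_def algebra_simps)
    finally show ?thesis
      unfolding F_exp \<rho>_def by (simp flip: exp_add)
  qed
  define S where "S = {R. R \<in> Pow J \<and> \<bar>k R / M - m\<bar> > \<delta>}"
  have finS: "finite S" using \<open>finite J\<close> by (simp add: S_def)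
  have "(\<Sum>R\<in>S. w R) = (\<Sum>\<kappa>\<in>k ` S. \<Sum>R | R \<in> S \<and> k R = \<kappa>. w R)"
    by (rule sum.image_gen[OF finS])
  also have "\<dots> \<le> (\<Sum>\<kappa>\<in>k ` S. \<rho> * F m)"
  proof (rule sum_mono)
    fix \<kappa> assume "\<kappa> \<in> k ` S"
    then have dev: "\<bar>\<kappa> / M - m\<bar> > \<delta>" by (auto simp: S_def)
    have "(\<Sum>R | R \<in> S \<and> k R = \<kappa>. w R)
        = (\<Sum>R | R \<in> S \<and> k R = \<kappa>. exp (\<theta> * (\<kappa> / M) * k R - \<theta> * M * (\<kappa> / M)\<^sup>2 / 2 + \<theta> * (\<Sum>j\<in>J. spin R j * s j)))"
      using M by (intro sum.cong refl) (auto simp: w_def k_def field_simps power2_eq_square)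
    also have "\<dots> \<le> F (\<kappa> / M)"
      unfolding F using \<open>finite J\<close> by (intro sum_mono2) (auto simp: S_def)
    also have "\<dots> \<le> \<rho> * F m" by (rule ratio[OF dev])
    finally show "(\<Sum>R | R \<in> S \<and> k R = \<kappa>. w R) \<le> \<rho> * F m" .
  qed
  also have "\<dots> = real (card (k ` S)) * (\<rho> * F m)" by simp
  also have "\<dots> \<le> (M + 1) * (\<rho> * F m)"
  proof (rule mult_right_mono)
    have "k ` S \<subseteq> (\<lambda>d. 2 * real d - M) ` {0..card J}"
      using \<open>finite J\<close> by (auto simp: k_def sum_spin M_def S_def intro!: imageI card_mono)
    then have "card (k ` S) \<le> card {0..card J}"
      by (meson card_image_le card_mono finite_atLeastAtMost finite_imageI le_trans)
    then show "real (card (k ` S)) \<le> M + 1" by (simp add: M_def)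
    show "0 \<le> \<rho> * F m" by (auto simp: \<rho>_def F_def intro!: prod_nonneg mult_nonneg_nonneg)
  qed
  also have "\<dots> \<le> (M + 1) * (\<rho> * (\<Sum>R\<in>Pow J. w R))"
    using F_le M by (intro mult_left_mono) (auto simp: \<rho>_def)
  finally show ?thesis by (simp add: S_def k_def \<rho>_def mult.assoc)
qed

section \<open>Degrees in spin coordinates\<close>

definition edges :: "'a set \<Rightarrow> 'a set set" where
  "edges V = {e. e \<subseteq> V \<and> card e = 2}"

definition spin_degree :: "'a set \<Rightarrow> 'a set set \<Rightarrow> 'a \<Rightarrow> real" where
  "spin_degree V S i = (\<Sum>j\<in>V - {i}. spin S {i, j})"

text \<open>The two star weight at \<open>\<theta>1 = 0\<close>, up to a constant factor, of the graph on \<open>V\<close> with edge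
  set \<open>S\<close>.\<close>

definition spin_weight :: "real \<Rightarrow> 'a set \<Rightarrow> 'a set set \<Rightarrow> real" where
  "spin_weight \<theta> V S = exp (\<theta> / (2 * (real (card V) - 1)) * (\<Sum>i\<in>V. (spin_degree V S i)\<^sup>2))"

text \<open>The affine image of \<open>d\<^sub>i / (n - 1)\<close> in \<open>[-1, 1]\<close>, with the two phases at \<open>m\<close> and \<open>- m\<close>.\<close>

definition scaled_degree :: "'a set \<Rightarrow> 'a set set \<Rightarrow> 'a \<Rightarrow> real" where
  "scaled_degree V S i = spin_degree V S i / (real (card V) - 1)"

text \<open>The sum runs over ordered pairs, so it is twice the energy cost in a sum over edges.\<close>

definition excess_energy :: "real \<Rightarrow> real \<Rightarrow> 'a set \<Rightarrow> ('a \<Rightarrow> real) \<Rightarrow> real" where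
  "excess_energy \<theta> m V t = (\<Sum>i\<in>V. \<Sum>j\<in>V - {i}. pair_energy \<theta> (t i) (t j) - pair_energy \<theta> m m)"

lemma finite_edges: "finite V \<Longrightarrow> finite (edges V)"
  by (rule finite_subset[of _ "Pow V"]) (auto simp: edges_def)

lemma doubleton_in_edges [simp]: "{i, j} \<in> edges V \<longleftrightarrow> i \<in> V \<and> j \<in> V \<and> i \<noteq> j"
  by (auto simp: edges_def card_2_iff)

lemma sum_incident_edges:
  assumes "i \<in> V"
  shows "(\<Sum>e | e \<in> edges V \<and> i \<in> e. f e) = (\<Sum>j\<in>V - {i}. f {i, j})"
proof -
  have "{e \<in> edges V. i \<in> e} = (\<lambda>j. {i, j}) ` (V - {i})"
    using assms by (fastforce simp: edges_def card_2_iff)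
  moreover have "inj_on (\<lambda>j. {i, j}) (V - {i})"
    by (auto simp: inj_on_def doubleton_eq_iff)
  ultimately show ?thesis by (simp add: sum.reindex)
qed

text \<open>Double counting of incident vertices and edges. It converts tilts of the degrees into fields on
  the edges.\<close>

lemma sum_edges_endpoints:
  assumes "finite V"
  shows "(\<Sum>i\<in>V. \<Sum>j\<in>V - {i}. f i {i, j}) = (\<Sum>e\<in>edges V. \<Sum>i\<in>e. f i e)"
proof -
  have "(\<Sum>i\<in>V. \<Sum>j\<in>V - {i}. f i {i, j}) = (\<Sum>i\<in>V. \<Sum>e | e \<in> edges V \<and> i \<in> e. f i e)"
    by (simp add: sum_incident_edges)
  also have "\<dots> = (\<Sum>e\<in>edges V. \<Sum>i | i \<in> V \<and> i \<in> e. f i e)"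
    by (rule sum.swap_restrict) (auto simp: assms finite_edges)
  also have "\<dots> = (\<Sum>e\<in>edges V. \<Sum>i\<in>e. f i e)"
    by (intro sum.cong refl) (auto simp: edges_def)
  finally show ?thesis .
qed

lemma sum_edges_half_pairs:
  fixes h :: "'a \<Rightarrow> 'a \<Rightarrow> real"
  assumes "finite V" and "\<And>i j. i \<in> V \<Longrightarrow> j \<in> V \<Longrightarrow> i \<noteq> j \<Longrightarrow> f {i, j} = h i j"
  shows "(\<Sum>e\<in>edges V. f e) = (\<Sum>i\<in>V. \<Sum>j\<in>V - {i}. h i j) / 2"
proof -
  have "(\<Sum>i\<in>V. \<Sum>j\<in>V - {i}. h i j) = (\<Sum>i\<in>V. \<Sum>j\<in>V - {i}. f {i, j})"
    using assms(2) by (intro sum.cong refl) auto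
  also have "\<dots> = (\<Sum>e\<in>edges V. \<Sum>i\<in>e. f e)" by (rule sum_edges_endpoints[OF assms(1)])
  also have "\<dots> = (\<Sum>e\<in>edges V. 2 * f e)"
    by (intro sum.cong refl) (auto simp: edges_def)
  finally show ?thesis by (simp flip: sum_distrib_left)
qed

lemma card_others: "finite V \<Longrightarrow> i \<in> V \<Longrightarrow> real (card (V - {i})) = real (card V) - 1"
  using card_Suc_Diff1[of V i] by linarith

lemma abs_spin_degree_le: "finite V \<Longrightarrow> i \<in> V \<Longrightarrow> \<bar>spin_degree V S i\<bar> \<le> real (card V) - 1"
  unfolding spin_degree_def
  by (rule order_trans[OF sum_abs]) (simp add: card_others del: card_Diff_insert)

lemma spin_degree_complement:
  "i \<in> V \<Longrightarrow> spin_degree V (edges V - S) i = - spin_degree V S i"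
  unfolding spin_degree_def sum_negf[symmetric] by (intro sum.cong) (auto simp: spin_def)

lemma spin_weight_complement: "spin_weight \<theta> V (edges V - S) = spin_weight \<theta> V S"
  by (simp add: spin_weight_def spin_degree_complement)

lemma sum_exp_spin_degrees:
  fixes a :: "'a \<Rightarrow> real"
  assumes "finite V"
  shows "(\<Sum>S\<in>Pow (edges V). exp (\<Sum>i\<in>V. a i * spin_degree V S i))
       = (\<Prod>e\<in>edges V. 2 * cosh (\<Sum>i\<in>e. a i))"
proof -
  have "(\<Sum>i\<in>V. a i * spin_degree V S i) = (\<Sum>e\<in>edges V. spin S e * (\<Sum>i\<in>e. a i))" for S
  proof -
    have "(\<Sum>i\<in>V. a i * spin_degree V S i) = (\<Sum>i\<in>V. \<Sum>j\<in>V - {i}. spin S {i, j} * a i)"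
      unfolding spin_degree_def sum_distrib_left by (intro sum.cong refl mult.commute)
    also have "\<dots> = (\<Sum>e\<in>edges V. \<Sum>i\<in>e. spin S e * a i)"
      by (rule sum_edges_endpoints[OF assms])
    finally show ?thesis by (simp add: sum_distrib_left)
  qed
  then show ?thesis by (simp add: sum_exp_spin finite_edges assms)
qed

lemma abs_scaled_degree_le: "finite V \<Longrightarrow> card V \<ge> 2 \<Longrightarrow> i \<in> V \<Longrightarrow> \<bar>scaled_degree V S i\<bar> \<le> 1"
  using abs_spin_degree_le[of V i S] by (simp add: scaled_degree_def field_simps abs_le_iff)

section \<open>Most vertices lie in a common phase\<close>

text \<open>A large deviation bound with the exact constant. The linearized weights have a factorizing sum
  \<open>F t\<close>, in which edge \<open>{i, j}\<close> carries the field \<open>\<theta> * (t i + t j)\<close>, so \<open>F t\<close> is the exponential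
  of minus the total pair energy of \<open>t\<close>, times the number of graphs. Linearization at \<open>t\<close> is exact
  on the graphs with degree sequence \<open>t\<close>. It bounds the weights of all graphs from below, and at
  the constant sequence \<open>m\<close> this yields the lower bound for the total weight.\<close>

lemma degree_sequence_weight:
  fixes \<theta> m :: real and t :: "'a \<Rightarrow> real"
  assumes "finite V" "card V \<ge> 2" "\<theta> > 0"
  defines "M \<equiv> real (card V) - 1"
  shows "(\<Sum>S | S \<in> Pow (edges V) \<and> (\<forall>i\<in>V. spin_degree V S i = M * t i). spin_weight \<theta> V S)
     \<le> exp (- excess_energy \<theta> m V t / 2) * (\<Sum>S\<in>Pow (edges V). spin_weight \<theta> V S)"
proof -
  have M: "M > 0" using assms(2) by (simp add: M_def)
  have card_J: "real (card (V - {i})) = M" if "i \<in> V" for i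
    using card_others[OF assms(1) that] by (simp only: M_def)
  define F where
    "F t = (\<Sum>S\<in>Pow (edges V). exp (\<Sum>i\<in>V. \<theta> * t i * spin_degree V S i - \<theta> * M * (t i)\<^sup>2 / 2))" for t
  have F: "F t = 2 ^ card (edges V) * exp (- (\<Sum>i\<in>V. \<Sum>j\<in>V - {i}. pair_energy \<theta> (t i) (t j)) / 2)" for t
  proof -
    have lncosh: "(\<Sum>e\<in>edges V. ln (cosh (\<Sum>i\<in>e. \<theta> * t i)))
        = (\<Sum>i\<in>V. \<Sum>j\<in>V - {i}. ln (cosh (\<theta> * (t i + t j)))) / 2"
      by (rule sum_edges_half_pairs[OF assms(1)]) (simp add: distrib_left)
    have sq: "(\<Sum>i\<in>V. \<Sum>j\<in>V - {i}. \<theta> / 2 * (t i)\<^sup>2) = (\<Sum>i\<in>V. \<theta> * M * (t i)\<^sup>2 / 2)"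
      using card_J by (intro sum.cong refl) simp
    have sq': "(\<Sum>i\<in>V. \<Sum>j\<in>V - {i}. \<theta> / 2 * (t j)\<^sup>2) = (\<Sum>i\<in>V. \<theta> * M * (t i)\<^sup>2 / 2)"
    proof -
      have "(\<Sum>i\<in>V. \<Sum>j | j \<in> V \<and> j \<noteq> i. \<theta> / 2 * (t j)\<^sup>2) = (\<Sum>j\<in>V. \<Sum>i | i \<in> V \<and> j \<noteq> i. \<theta> / 2 * (t j)\<^sup>2)"
        using assms(1) by (intro sum.swap_restrict)
      moreover have "{i \<in> V. j \<noteq> i} = V - {j}" "{i \<in> V. i \<noteq> j} = V - {j}" for j by auto
      ultimately show ?thesis using sq by simp
    qed
    have "F t = exp (- (\<Sum>i\<in>V. \<theta> * M * (t i)\<^sup>2 / 2))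
        * (\<Sum>S\<in>Pow (edges V). exp (\<Sum>i\<in>V. \<theta> * t i * spin_degree V S i))"
      unfolding F_def sum_subtractf by (simp add: sum_distrib_left flip: exp_add)
    also have "\<dots> = exp (- (\<Sum>i\<in>V. \<theta> * M * (t i)\<^sup>2 / 2))
        * (2 ^ card (edges V) * exp (\<Sum>e\<in>edges V. ln (cosh (\<Sum>i\<in>e. \<theta> * t i))))"
      unfolding sum_exp_spin_degrees[OF assms(1)] using assms(1)
      by (simp add: prod.distrib exp_sum finite_edges cosh_real_pos)
    also have "\<dots> = 2 ^ card (edges V) * exp (- (\<Sum>i\<in>V. \<Sum>j\<in>V - {i}. pair_energy \<theta> (t i) (t j)) / 2)"
      unfolding lncosh pair_energy_def sum_subtractf distrib_left sum.distrib sq sq'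
      by (simp add: field_simps flip: exp_add)
    finally show ?thesis .
  qed
  have F_le: "F (\<lambda>_. m) \<le> (\<Sum>S\<in>Pow (edges V). spin_weight \<theta> V S)"
    unfolding F_def spin_weight_def sum_distrib_left
    using exp_square_tangent[OF assms(3) M, of m] by (intro sum_mono) (auto simp: M_def intro!: sum_mono)
  have "(\<Sum>S | S \<in> Pow (edges V) \<and> (\<forall>i\<in>V. spin_degree V S i = M * t i). spin_weight \<theta> V S)
      = (\<Sum>S | S \<in> Pow (edges V) \<and> (\<forall>i\<in>V. spin_degree V S i = M * t i).
           exp (\<Sum>i\<in>V. \<theta> * t i * spin_degree V S i - \<theta> * M * (t i)\<^sup>2 / 2))"
    unfolding spin_weight_def sum_distrib_left M_def[symmetric]
    using M by (intro sum.cong refl arg_cong[of _ _ exp]) (auto simp: field_simps power2_eq_square)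
  also have "\<dots> \<le> F t"
    unfolding F_def using assms(1) by (intro sum_mono2) (auto simp: finite_edges)
  also have "F t = exp (- (\<Sum>i\<in>V. \<Sum>j\<in>V - {i}. pair_energy \<theta> (t i) (t j) - pair_energy \<theta> m m) / 2)
       * F (\<lambda>_. m)"
    unfolding F sum_subtractf by (simp add: field_simps flip: exp_add)
  also have "\<dots> \<le> exp (- (\<Sum>i\<in>V. \<Sum>j\<in>V - {i}. pair_energy \<theta> (t i) (t j) - pair_energy \<theta> m m) / 2)
       * (\<Sum>S\<in>Pow (edges V). spin_weight \<theta> V S)"
    using F_le by (intro mult_left_mono) auto
  finally show ?thesis unfolding excess_energy_def .
qed

text \<open>Each degree takes at most \<open>card V\<close> values, so a union bound over degree sequences costs the
  factor \<open>card V ^ card V\<close>.\<close>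

lemma large_excess_weight:
  fixes \<theta> m a :: real
  assumes "finite V" "card V \<ge> 2" "\<theta> > 0"
  shows "(\<Sum>S | S \<in> Pow (edges V) \<and> excess_energy \<theta> m V (scaled_degree V S) \<ge> a. spin_weight \<theta> V S)
     \<le> real (card V ^ card V) * exp (- a / 2) * (\<Sum>S\<in>Pow (edges V). spin_weight \<theta> V S)"
proof -
  define M where "M = real (card V) - 1"
  have M: "M > 0" using assms(2) by (simp add: M_def)
  define B where "B = {S. S \<in> Pow (edges V) \<and> excess_energy \<theta> m V (scaled_degree V S) \<ge> a}"
  define Z where "Z = (\<Sum>S\<in>Pow (edges V). spin_weight \<theta> V S)"
  have Z: "Z \<ge> 0" unfolding Z_def spin_weight_def by (intro sum_nonneg) auto
  define g where "g S = restrict (scaled_degree V S) V" for S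
  have finB: "finite B" using assms(1) by (simp add: B_def finite_edges)
  have "(\<Sum>S\<in>B. spin_weight \<theta> V S) = (\<Sum>t\<in>g ` B. \<Sum>S | S \<in> B \<and> g S = t. spin_weight \<theta> V S)"
    by (rule sum.image_gen[OF finB])
  also have "\<dots> \<le> (\<Sum>t\<in>g ` B. exp (- a / 2) * Z)"
  proof (rule sum_mono)
    fix t assume "t \<in> g ` B"
    then obtain S where S: "S \<in> B" "t = g S" by auto
    have "excess_energy \<theta> m V t = excess_energy \<theta> m V (scaled_degree V S)"
      unfolding excess_energy_def S(2) g_def by (intro sum.cong refl) auto
    then have a: "excess_energy \<theta> m V t \<ge> a" using S(1) by (simp add: B_def)
    have "(\<Sum>S | S \<in> B \<and> g S = t. spin_weight \<theta> V S)
        \<le> (\<Sum>S | S \<in> Pow (edges V) \<and> (\<forall>i\<in>V. spin_degree V S i = M * t i). spin_weight \<theta> V S)"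
      using M assms(1)
      by (intro sum_mono2) (auto simp: B_def g_def finite_edges scaled_degree_def M_def spin_weight_def)
    also have "\<dots> \<le> exp (- excess_energy \<theta> m V t / 2) * Z"
      unfolding M_def Z_def by (rule degree_sequence_weight[OF assms])
    also have "\<dots> \<le> exp (- a / 2) * Z" using a Z by (intro mult_right_mono) auto
    finally show "(\<Sum>S | S \<in> B \<and> g S = t. spin_weight \<theta> V S) \<le> exp (- a / 2) * Z" .
  qed
  also have "\<dots> = real (card (g ` B)) * (exp (- a / 2) * Z)" by simp
  also have "\<dots> \<le> real (card V ^ card V) * (exp (- a / 2) * Z)"
  proof (rule mult_right_mono)
    define K where "K = (\<lambda>d. (2 * real d - M) / M) ` {0..<card V}"
    have K: "scaled_degree V S i \<in> K" if "i \<in> V" for S i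
    proof -
      have inj: "inj_on (\<lambda>j. {i, j}) (V - {i})" by (auto simp: inj_on_def doubleton_eq_iff)
      have cJ: "card (V - {i}) = card V - 1" using that by simp
      have "spin_degree V S i = (\<Sum>e\<in>(\<lambda>j. {i, j}) ` (V - {i}). spin S e)"
        by (simp add: spin_degree_def sum.reindex[OF inj])
      also have "\<dots> = 2 * real (card ((\<lambda>j. {i, j}) ` (V - {i}) \<inter> S)) - M"
        using assms cJ by (simp add: sum_spin card_image[OF inj] M_def of_nat_diff)
      finally have "scaled_degree V S i = (2 * real (card ((\<lambda>j. {i, j}) ` (V - {i}) \<inter> S)) - M) / M"
        by (simp add: scaled_degree_def M_def)
      moreover have "card ((\<lambda>j. {i, j}) ` (V - {i}) \<inter> S) \<le> card ((\<lambda>j. {i, j}) ` (V - {i}))"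
        using assms(1) by (intro card_mono) auto
      then have "card ((\<lambda>j. {i, j}) ` (V - {i}) \<inter> S) < card V"
        using assms(2) cJ by (simp add: card_image[OF inj])
      ultimately show ?thesis by (auto simp: K_def)
    qed
    have finK: "finite K" by (simp add: K_def)
    have "g ` B \<subseteq> (PiE V (\<lambda>_. K))" using K by (auto simp: g_def)
    then have "card (g ` B) \<le> card (PiE V (\<lambda>_. K))"
      using assms(1) finK by (intro card_mono finite_PiE) auto
    also have "\<dots> = card K ^ card V" using assms(1) by (simp add: card_PiE)
    also have "\<dots> \<le> card V ^ card V"
      unfolding K_def by (intro power_mono order_trans[OF card_image_le]) auto
    finally show "real (card (g ` B)) \<le> real (card V ^ card V)" by (simp only: of_nat_le_iff)
    show "0 \<le> exp (- a / 2) * Z" using Z by simp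
  qed
  finally show ?thesis unfolding B_def Z_def by (simp add: mult.assoc)
qed

text \<open>Some vertex \<open>i\<close> carries at most the average share of the excess energy. Its sign selects the
  phase, and the hypothesis bounds the distance of every other vertex to that phase by the energy
  of its pair with \<open>i\<close>. The summand 2 accounts for \<open>i\<close> itself.\<close>

lemma near_phase_of_small_excess:
  fixes t :: "'a \<Rightarrow> real"
  assumes "finite V" "V \<noteq> {}" "\<And>i. i \<in> V \<Longrightarrow> \<bar>t i\<bar> \<le> 1" "0 < m" "m < 1" "K > 0"
    and K: "\<And>s t. \<bar>s\<bar> \<le> 1 \<Longrightarrow> \<bar>t\<bar> \<le> 1 \<Longrightarrow>
       \<bar>s - (if t \<ge> 0 then m else - m)\<bar> \<le> \<epsilon> + K * (pair_energy \<theta> s t - pair_energy \<theta> m m)"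
  shows "\<exists>p\<in>{m, - m}. (\<Sum>i\<in>V. \<bar>t i - p\<bar>)
           \<le> 2 + \<epsilon> * (real (card V) - 1) + K * excess_energy \<theta> m V t / real (card V)"
proof -
  define D where "D i = (\<Sum>j\<in>V - {i}. pair_energy \<theta> (t j) (t i) - pair_energy \<theta> m m)" for i
  have X: "excess_energy \<theta> m V t = (\<Sum>i\<in>V. D i)"
    unfolding excess_energy_def D_def by (intro sum.cong refl) (simp add: pair_energy_commute)
  have n: "real (card V) > 0" using assms(1,2) by (simp add: card_gt_0_iff)
  have "\<exists>i\<in>V. D i \<le> (\<Sum>i\<in>V. D i) / real (card V)"
  proof (rule ccontr)
    assume "\<not> ?thesis"
    then have "(\<Sum>i\<in>V. (\<Sum>i\<in>V. D i) / real (card V)) < (\<Sum>i\<in>V. D i)"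
      using assms(1,2) by (intro sum_strict_mono) auto
    then show False using n by simp
  qed
  then obtain i where i: "i \<in> V" "D i \<le> excess_energy \<theta> m V t / real (card V)" using X by auto
  define p where "p = (if t i \<ge> 0 then m else - m)"
  have "(\<Sum>j\<in>V. \<bar>t j - p\<bar>) = \<bar>t i - p\<bar> + (\<Sum>j\<in>V - {i}. \<bar>t j - p\<bar>)"
    using assms(1) i(1) by (rule sum.remove)
  also have "\<bar>t i - p\<bar> \<le> 2" using assms(3)[OF i(1)] assms(4,5) by (auto simp: p_def)
  also have "(\<Sum>j\<in>V - {i}. \<bar>t j - p\<bar>)
      \<le> (\<Sum>j\<in>V - {i}. \<epsilon> + K * (pair_energy \<theta> (t j) (t i) - pair_energy \<theta> m m))"
    unfolding p_def using assms(3) i(1) by (intro sum_mono K) auto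
  also have "\<dots> = \<epsilon> * (real (card V) - 1) + K * D i"
    unfolding sum.distrib sum_distrib_left[symmetric] sum_constant card_others[OF assms(1) i(1)]
    by (simp add: D_def mult.commute)
  also have "K * D i \<le> K * (excess_energy \<theta> m V t / real (card V))"
    using i(2) assms(6) by (intro mult_left_mono) auto
  finally have "(\<Sum>i\<in>V. \<bar>t i - p\<bar>) \<le> 2 + \<epsilon> * (real (card V) - 1) + K * excess_energy \<theta> m V t / real (card V)"
    by simp
  moreover have "p \<in> {m, - m}" by (simp add: p_def)
  ultimately show ?thesis by blast
qed

section \<open>Resampling the edges at one vertex\<close>

lemma sum_Pow_edges_split_vertex:
  assumes "i \<in> V"
  shows "(\<Sum>S\<in>Pow (edges V). g S)
       = (\<Sum>T\<in>Pow (edges (V - {i})). \<Sum>R\<in>Pow (V - {i}). g (T \<union> (\<lambda>j. {i, j}) ` R))"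
proof -
  have eq: "{e \<in> S. i \<notin> e} \<union> (\<lambda>j. {i, j}) ` {j \<in> V - {i}. {i, j} \<in> S} = S"
    if S: "S \<subseteq> edges V" for S
  proof -
    have "e \<in> (\<lambda>j. {i, j}) ` {j \<in> V - {i}. {i, j} \<in> S}" if e: "e \<in> S" "i \<in> e" for e
    proof -
      obtain a b where "e = {a, b}" "a \<noteq> b" "a \<in> V" "b \<in> V"
        using S e(1) unfolding edges_def card_2_iff by auto
      then obtain j where "e = {i, j}" "j \<in> V - {i}" using e(2) by blast
      then show ?thesis using e(1) by blast
    qed
    then show ?thesis by blast
  qed
  have "(\<Sum>S\<in>Pow (edges V). g S)
      = (\<Sum>(T, R)\<in>Pow (edges (V - {i})) \<times> Pow (V - {i}). g (T \<union> (\<lambda>j. {i, j}) ` R))"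
  proof (rule sum.reindex_bij_witness[where
        i = "\<lambda>(T, R). T \<union> (\<lambda>j. {i, j}) ` R" and
        j = "\<lambda>S. ({e \<in> S. i \<notin> e}, {j \<in> V - {i}. {i, j} \<in> S})"], goal_cases)
    case (1 S)
    then show ?case using eq by simp
  next
    case (2 S)
    then show ?case by (auto simp: edges_def)
  next
    case (3 p)
    obtain T R where p: "p = (T, R)" by (cases p)
    have T: "\<And>e. e \<in> T \<Longrightarrow> i \<notin> e" and R: "R \<subseteq> V - {i}" using 3 by (auto simp: edges_def p)
    have "{e \<in> T \<union> (\<lambda>j. {i, j}) ` R. i \<notin> e} = T" using T by blast
    moreover have "{j \<in> V - {i}. {i, j} \<in> T \<union> (\<lambda>j. {i, j}) ` R} = R"
      using T R by (auto simp: doubleton_eq_iff)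
    ultimately show ?case by (simp add: p)
  next
    case (4 p)
    obtain T R where p: "p = (T, R)" by (cases p)
    have "T \<subseteq> edges V" "R \<subseteq> V - {i}" using 4 by (auto simp: edges_def p)
    then show ?case using assms by (auto simp: p)
  next
    case (5 S)
    then show ?case using eq by simp
  qed
  then show ?thesis by (simp add: sum.cartesian_product)
qed

text \<open>Split the graph into its restriction \<open>T\<close> to \<open>V - {i}\<close> and the set \<open>R\<close> of neighbours of \<open>i\<close>. For
  fixed \<open>T\<close> the weight is, up to a constant, that of a Curie-Weiss model in \<open>R\<close> whose fields are
  proportional to the degrees in \<open>T\<close>. The condition on the mean distance to the phase involves \<open>R\<close> as well, but
  removing the spins at \<open>i\<close> changes it by at most 1 in total, which explains \<open>\<eta> + 1\<close>.\<close>

lemma vertex_deviation: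
  fixes \<theta> m \<delta> \<eta> :: real
  assumes "finite V" "card V \<ge> 2" "i \<in> V" "\<theta> > 0" "\<delta> > 0"
    and min: "\<And>u. pair_energy \<theta> m m \<le> pair_energy \<theta> u u"
  shows "(\<Sum>S | S \<in> Pow (edges V) \<and> (\<Sum>j\<in>V. \<bar>scaled_degree V S j - m\<bar>) \<le> \<eta>
              \<and> \<bar>scaled_degree V S i - m\<bar> > \<delta>. spin_weight \<theta> V S)
     \<le> real (card V) * exp (2 * \<theta> * (\<eta> + 1) - (real (card V) - 1) * \<theta> * \<delta>\<^sup>2 / 4)
       * (\<Sum>S\<in>Pow (edges V). spin_weight \<theta> V S)"
    (is "sum _ {S. S \<in> _ \<and> ?P S} \<le> ?c * _")
proof -
  define J where "J = V - {i}"
  define M where "M = real (card V) - 1"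
  have J: "finite J" "real (card J) = M"
    using assms(1) card_others[OF assms(1,3)] by (simp_all only: J_def M_def finite_Diff)
  have M: "M > 0" using assms(2) by (simp add: M_def)
  then have "J \<noteq> {}" using J(2) by auto
  define join where "join T R = T \<union> (\<lambda>j. {i, j}) ` R" for T R
  define s where "s T j = spin_degree J T j / M" for T j
  define w where "w T R = exp (\<theta> / (2 * M) * (\<Sum>j\<in>J. spin R j)\<^sup>2 + \<theta> * (\<Sum>j\<in>J. spin R j * s T j))" for T R
  define c where "c T = exp (\<theta> / (2 * M) * (\<Sum>j\<in>J. 1 + (spin_degree J T j)\<^sup>2))" for T
  have deg_i: "spin_degree V (join T R) i = (\<Sum>j\<in>J. spin R j)"
    if "T \<subseteq> edges J" "R \<subseteq> J" for T R
    unfolding spin_degree_def J_def[symmetric]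
  proof (rule sum.cong[OF refl])
    fix j assume "j \<in> J"
    then have "{i, j} \<in> join T R \<longleftrightarrow> j \<in> R"
      using that by (auto simp: join_def edges_def J_def doubleton_eq_iff)
    then show "spin (join T R) {i, j} = spin R j" by (simp add: spin_def)
  qed
  have deg_j: "spin_degree V (join T R) j = spin R j + spin_degree J T j"
    if "T \<subseteq> edges J" "R \<subseteq> J" "j \<in> J" for T R j
  proof -
    have "V - {j} = insert i (J - {j})" "i \<notin> J - {j}"
      using assms(3) that(3) by (auto simp: J_def)
    then have "spin_degree V (join T R) j
        = spin (join T R) {j, i} + (\<Sum>l\<in>J - {j}. spin (join T R) {j, l})"
      using J(1) by (simp add: spin_degree_def)
    also have "{j, i} \<in> join T R \<longleftrightarrow> j \<in> R"
      using that by (auto simp: join_def edges_def J_def doubleton_eq_iff)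
    then have "spin (join T R) {j, i} = spin R j" by (simp add: spin_def)
    also have "(\<Sum>l\<in>J - {j}. spin (join T R) {j, l}) = spin_degree J T j"
      unfolding spin_degree_def
    proof (rule sum.cong[OF refl])
      fix l assume "l \<in> J - {j}"
      then have "{j, l} \<in> join T R \<longleftrightarrow> {j, l} \<in> T"
        using that by (auto simp: join_def J_def doubleton_eq_iff)
      then show "spin (join T R) {j, l} = spin T {j, l}" by (simp add: spin_def)
    qed
    finally show ?thesis .
  qed
  have weight: "spin_weight \<theta> V (join T R) = c T * w T R" if "T \<subseteq> edges J" "R \<subseteq> J" for T R
  proof -
    have "(\<Sum>l\<in>V. (spin_degree V (join T R) l)\<^sup>2)
        = (\<Sum>j\<in>J. spin R j)\<^sup>2 + (\<Sum>j\<in>J. (spin R j + spin_degree J T j)\<^sup>2)"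
      using assms(1,3) that by (simp add: sum.remove[of V i] deg_i deg_j flip: J_def)
    also have "(\<Sum>j\<in>J. (spin R j + spin_degree J T j)\<^sup>2)
        = (\<Sum>j\<in>J. 1 + (spin_degree J T j)\<^sup>2) + (\<Sum>j\<in>J. 2 * M * (spin R j * s T j))"
      unfolding sum.distrib[symmetric] using M by (intro sum.cong refl) (simp add: s_def power2_sum)
    also have "(\<Sum>j\<in>J. 2 * M * (spin R j * s T j)) = 2 * M * (\<Sum>j\<in>J. spin R j * s T j)"
      by (simp only: sum_distrib_left)
    finally show ?thesis
      using M unfolding spin_weight_def c_def w_def M_def[symmetric]
      by (simp add: distrib_left flip: exp_add)
  qed
  have nonneg: "0 \<le> c T" "0 \<le> w T R" for T R by (simp_all add: c_def w_def)
  have row: "(\<Sum>R\<in>Pow J. if ?P (join T R) then spin_weight \<theta> V (join T R) else 0)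
      \<le> ?c * (\<Sum>R\<in>Pow J. spin_weight \<theta> V (join T R))" if T: "T \<in> Pow (edges J)" for T
    \<comment> \<open>Either the fields are close to the phase, or no choice of \<open>R\<close> satisfies the condition.\<close>
  proof (cases "(\<Sum>j\<in>J. \<bar>s T j - m\<bar>) \<le> \<eta> + 1")
    case True
    have "(\<Sum>R\<in>Pow J. if ?P (join T R) then spin_weight \<theta> V (join T R) else 0)
        \<le> (\<Sum>R\<in>Pow J. if \<bar>(\<Sum>j\<in>J. spin R j) / M - m\<bar> > \<delta> then c T * w T R else 0)"
      using T weight deg_i nonneg
      by (intro sum_mono) (auto simp: scaled_degree_def simp flip: M_def)
    also have "\<dots> = c T * (\<Sum>R | R \<in> Pow J \<and> \<bar>(\<Sum>j\<in>J. spin R j) / M - m\<bar> > \<delta>. w T R)"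
      using J(1) by (simp add: sum_distrib_left sum.inter_filter[symmetric] finite_Pow_iff)
    also have "\<dots> \<le> c T * ((M + 1) * exp (2 * \<theta> * (\<Sum>j\<in>J. \<bar>s T j - m\<bar>) - M * \<theta> * \<delta>\<^sup>2 / 4)
        * (\<Sum>R\<in>Pow J. w T R))"
      unfolding w_def J(2)[symmetric]
      by (intro mult_left_mono curie_weiss_deviation J \<open>J \<noteq> {}\<close> assms nonneg)
    also have "\<dots> \<le> c T * (?c * (\<Sum>R\<in>Pow J. w T R))"
    proof (intro mult_left_mono mult_right_mono nonneg sum_nonneg)
      show "(M + 1) * exp (2 * \<theta> * (\<Sum>j\<in>J. \<bar>s T j - m\<bar>) - M * \<theta> * \<delta>\<^sup>2 / 4) \<le> ?c"
        using True assms(4) unfolding M_def by (intro mult_mono) auto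
    qed
    also have "\<dots> = ?c * (\<Sum>R\<in>Pow J. spin_weight \<theta> V (join T R))"
      using T by (simp add: weight sum_distrib_left mult_ac)
    finally show ?thesis .
  next
    case False
    have "\<not> ?P (join T R)" if R: "R \<in> Pow J" for R
    proof
      assume P: "?P (join T R)"
      have "(\<Sum>j\<in>J. \<bar>s T j - m\<bar>) \<le> (\<Sum>j\<in>J. \<bar>scaled_degree V (join T R) j - m\<bar> + 1 / M)"
      proof (rule sum_mono)
        fix j assume "j \<in> J"
        then have "s T j - m = (scaled_degree V (join T R) j - m) - spin R j / M"
          using deg_j[of T R j] T R by (simp add: s_def scaled_degree_def add_divide_distrib flip: M_def)
        moreover have "\<bar>spin R j / M\<bar> = 1 / M" using M by simp
        ultimately show "\<bar>s T j - m\<bar> \<le> \<bar>scaled_degree V (join T R) j - m\<bar> + 1 / M" by linarith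
      qed
      also have "\<dots> = (\<Sum>j\<in>J. \<bar>scaled_degree V (join T R) j - m\<bar>) + 1"
        using M J(2) by (simp add: sum.distrib)
      also have "(\<Sum>j\<in>J. \<bar>scaled_degree V (join T R) j - m\<bar>) \<le> (\<Sum>j\<in>V. \<bar>scaled_degree V (join T R) j - m\<bar>)"
        using assms(1) by (intro sum_mono2) (auto simp: J_def)
      finally show False using P False by simp
    qed
    then have "(\<Sum>R\<in>Pow J. if ?P (join T R) then spin_weight \<theta> V (join T R) else 0) = 0"
      by (intro sum.neutral) auto
    also have "0 \<le> ?c * (\<Sum>R\<in>Pow J. spin_weight \<theta> V (join T R))"
      by (auto intro!: mult_nonneg_nonneg sum_nonneg simp: spin_weight_def)
    finally show ?thesis .
  qed
  have "(\<Sum>S | S \<in> Pow (edges V) \<and> ?P S. spin_weight \<theta> V S)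
      = (\<Sum>S\<in>Pow (edges V). if ?P S then spin_weight \<theta> V S else 0)"
    using assms(1) by (intro sum.inter_filter) (simp add: finite_edges)
  also have "\<dots> = (\<Sum>T\<in>Pow (edges J). \<Sum>R\<in>Pow J. if ?P (join T R) then spin_weight \<theta> V (join T R) else 0)"
    unfolding J_def join_def by (rule sum_Pow_edges_split_vertex[OF assms(3)])
  also have "\<dots> \<le> (\<Sum>T\<in>Pow (edges J). ?c * (\<Sum>R\<in>Pow J. spin_weight \<theta> V (join T R)))"
    by (rule sum_mono[OF row])
  also have "\<dots> = ?c * (\<Sum>S\<in>Pow (edges V). spin_weight \<theta> V S)"
    unfolding J_def join_def sum_Pow_edges_split_vertex[OF assms(3)] sum_distrib_left ..
  finally show ?thesis .
qed

section \<open>The weight of graphs in neither phase\<close>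

lemma sum_Un_le:
  fixes f :: "'a \<Rightarrow> real"
  assumes "finite A" "finite B" "\<And>x. f x \<ge> 0"
  shows "sum f (A \<union> B) \<le> sum f A + sum f B"
  using assms by (simp add: sum_Un sum_nonneg)

lemma sum_UN_le:
  fixes f :: "'a \<Rightarrow> real"
  assumes "finite I" "\<And>i. i \<in> I \<Longrightarrow> finite (A i)" "\<And>x. f x \<ge> 0"
  shows "sum f (\<Union>i\<in>I. A i) \<le> (\<Sum>i\<in>I. sum f (A i))"
  using assms(1,2)
proof (induction I rule: finite_induct)
  case (insert i I)
  have "sum f (\<Union>i\<in>insert i I. A i) \<le> sum f (A i) + sum f (\<Union>i\<in>I. A i)"
    using insert by (simp add: sum_Un_le assms(3))
  then show ?case using insert by fastforce
qed simp

text \<open>Either the excess energy is of order \<open>n\<^sup>2\<close>, which \<open>large_excess_weight\<close> covers, or the scaled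
  degrees are on average close to a phase \<open>p\<close>. In the second case some vertex still deviates from
  \<open>p\<close>, which \<open>vertex_deviation\<close> covers for each of the two phases and \<open>n\<close> vertices.\<close>

lemma no_phase_weight:
  fixes \<theta> m \<delta> :: real
  assumes "\<theta> > 0" "0 < m" "m < 1" "\<delta> > 0"
    and min: "\<And>u. u \<noteq> m \<Longrightarrow> u \<noteq> - m \<Longrightarrow> pair_energy \<theta> m m < pair_energy \<theta> u u"
  obtains c where "c > 0"
    "\<And>V :: 'a set. finite V \<Longrightarrow> card V \<ge> 2 \<Longrightarrow>
       (\<Sum>S | S \<in> Pow (edges V) \<and> (\<forall>p\<in>{m, - m}. \<exists>i\<in>V. \<bar>scaled_degree V S i - p\<bar> > \<delta>). spin_weight \<theta> V S)
       \<le> (real (card V ^ card V) * exp (- c * real (card V) * (real (card V) - 1))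
          + 2 * (real (card V))\<^sup>2 * exp (6 * \<theta> - (real (card V) - 1) * (\<theta> * \<delta>\<^sup>2 / 8)))
         * (\<Sum>S\<in>Pow (edges V). spin_weight \<theta> V S)"
proof -
  have min_m: "pair_energy \<theta> m m \<le> pair_energy \<theta> u u" for u
    using min[of u] pair_energy_minus[of \<theta> m m] by (cases "u = m \<or> u = - m") auto
  \<comment> \<open>Small enough for the cost \<open>4 * \<theta> * \<epsilon> * (n - 1)\<close> of imperfect fields to use up only a quarter
      of the gain \<open>(n - 1) * \<theta> * \<delta>\<^sup>2 / 4\<close>.\<close>
  define \<epsilon> where "\<epsilon> = \<delta>\<^sup>2 / 64"
  have "\<epsilon> > 0" using assms(4) by (simp add: \<epsilon>_def)
  obtain K where K: "K > 0"
    "\<And>s t. \<bar>s\<bar> \<le> 1 \<Longrightarrow> \<bar>t\<bar> \<le> 1 \<Longrightarrow>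
       \<bar>s - (if t \<ge> 0 then m else - m)\<bar> \<le> \<epsilon> + K * (pair_energy \<theta> s t - pair_energy \<theta> m m)"
    using phase_distance_le_pair_excess[OF assms(1-3) min \<open>\<epsilon> > 0\<close>] by metis
  show ?thesis
  proof
    show "\<epsilon> / (2 * K) > 0" using \<open>\<epsilon> > 0\<close> K by simp
    fix V :: "'a set"
    assume V: "finite V" "card V \<ge> 2"
    define n where "n = real (card V)"
    define W where "W = spin_weight \<theta> V"
    define Z where "Z = (\<Sum>S\<in>Pow (edges V). W S)"
    define a where "a = \<epsilon> / K * n * (n - 1)"
    define \<eta> where "\<eta> = 2 + 2 * \<epsilon> * (n - 1)"
    define far where "far S = (excess_energy \<theta> m V (scaled_degree V S) \<ge> a)" for S
    define dev where "dev p i S = ((\<Sum>j\<in>V. \<bar>scaled_degree V S j - p\<bar>) \<le> \<eta> \<and> \<bar>scaled_degree V S i - p\<bar> > \<delta>)" for p i S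
    define B where "B = {S. S \<in> Pow (edges V) \<and> (\<forall>p\<in>{m, - m}. \<exists>i\<in>V. \<bar>scaled_degree V S i - p\<bar> > \<delta>)}"
    define r where "r = n * exp (6 * \<theta> - (n - 1) * (\<theta> * \<delta>\<^sup>2 / 8))"
    have n: "n \<ge> 2" using V by (simp add: n_def)
    have W: "W S \<ge> 0" for S by (simp add: W_def spin_weight_def)
    have Z: "Z \<ge> 0" unfolding Z_def by (intro sum_nonneg W)
    have fin: "finite {S. S \<in> Pow (edges V) \<and> P S}" for P using V by (simp add: finite_edges)
    have dev_le: "(\<Sum>S | S \<in> Pow (edges V) \<and> dev p i S. W S) \<le> r * Z" if "p \<in> {m, - m}" "i \<in> V" for p i
    proof -
      have "pair_energy \<theta> p p \<le> pair_energy \<theta> u u" for u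
        using that(1) min_m[of u] pair_energy_minus[of \<theta> m m] by auto
      then have "(\<Sum>S | S \<in> Pow (edges V) \<and> dev p i S. W S)
          \<le> n * exp (2 * \<theta> * (\<eta> + 1) - (n - 1) * \<theta> * \<delta>\<^sup>2 / 4) * Z"
        unfolding dev_def W_def Z_def n_def by (intro vertex_deviation V that assms)
      also have "2 * \<theta> * (\<eta> + 1) - (n - 1) * \<theta> * \<delta>\<^sup>2 / 4 = 6 * \<theta> - 3 / 2 * ((n - 1) * (\<theta> * \<delta>\<^sup>2 / 8))"
        by (simp add: \<eta>_def \<epsilon>_def field_simps)
      also have "n * exp \<dots> * Z \<le> r * Z"
      proof -
        have "0 \<le> (n - 1) * (\<theta> * \<delta>\<^sup>2 / 8)" using n assms(1) by simp
        then have "6 * \<theta> - 3 / 2 * ((n - 1) * (\<theta> * \<delta>\<^sup>2 / 8)) \<le> 6 * \<theta> - (n - 1) * (\<theta> * \<delta>\<^sup>2 / 8)"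
          by linarith
        then show ?thesis
          unfolding r_def using n Z by (intro mult_right_mono mult_left_mono exp_le_cancel_iff[THEN iffD2]) auto
      qed
      finally show ?thesis .
    qed
    have "B \<subseteq> {S. S \<in> Pow (edges V) \<and> far S} \<union> (\<Union>p\<in>{m, - m}. \<Union>i\<in>V. {S. S \<in> Pow (edges V) \<and> dev p i S})"
    proof
      fix S assume S: "S \<in> B"
      show "S \<in> {S. S \<in> Pow (edges V) \<and> far S} \<union> (\<Union>p\<in>{m, - m}. \<Union>i\<in>V. {S. S \<in> Pow (edges V) \<and> dev p i S})"
      proof (cases "far S")
        case True
        then show ?thesis using S by (simp add: B_def)
      next
        case False
        have "V \<noteq> {}" using V by auto
        have "\<exists>p\<in>{m, - m}. (\<Sum>i\<in>V. \<bar>scaled_degree V S i - p\<bar>)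
            \<le> 2 + \<epsilon> * (n - 1) + K * excess_energy \<theta> m V (scaled_degree V S) / n"
          unfolding n_def
          by (rule near_phase_of_small_excess[OF V(1) \<open>V \<noteq> {}\<close> abs_scaled_degree_le[OF V] assms(2,3) K])
        then obtain p where p: "p \<in> {m, - m}" "(\<Sum>i\<in>V. \<bar>scaled_degree V S i - p\<bar>)
            \<le> 2 + \<epsilon> * (n - 1) + K * excess_energy \<theta> m V (scaled_degree V S) / n"
          by (rule bexE)
        have "K * excess_energy \<theta> m V (scaled_degree V S) / n \<le> K * a / n"
          using False K(1) n by (intro divide_right_mono mult_left_mono) (auto simp: far_def)
        also have "\<dots> = \<epsilon> * (n - 1)" using K(1) n by (simp add: a_def)
        finally have "(\<Sum>i\<in>V. \<bar>scaled_degree V S i - p\<bar>) \<le> \<eta>" using p(2) by (simp add: \<eta>_def)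
        then show ?thesis using p(1) S unfolding B_def dev_def by blast
      qed
    qed
    then have "(\<Sum>S\<in>B. W S) \<le> (\<Sum>S\<in>{S. S \<in> Pow (edges V) \<and> far S} \<union> (\<Union>p\<in>{m, - m}. \<Union>i\<in>V. {S. S \<in> Pow (edges V) \<and> dev p i S}). W S)"
      using V(1) by (intro sum_mono2 W finite_UnI finite_UN_I fin) auto
    also have "\<dots> \<le> (\<Sum>S | S \<in> Pow (edges V) \<and> far S. W S)
        + (\<Sum>S\<in>(\<Union>p\<in>{m, - m}. \<Union>i\<in>V. {S. S \<in> Pow (edges V) \<and> dev p i S}). W S)"
      using V(1) by (intro sum_Un_le) (auto simp: fin[simplified] W)
    also have "(\<Sum>S | S \<in> Pow (edges V) \<and> far S. W S) \<le> real (card V ^ card V) * exp (- a / 2) * Z"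
      unfolding far_def W_def Z_def by (rule large_excess_weight[OF V assms(1)])
    also have "(\<Sum>S\<in>(\<Union>p\<in>{m, - m}. \<Union>i\<in>V. {S. S \<in> Pow (edges V) \<and> dev p i S}). W S)
        \<le> (\<Sum>p\<in>{m, - m}. \<Sum>i\<in>V. \<Sum>S | S \<in> Pow (edges V) \<and> dev p i S. W S)"
      using V(1) W by (intro order_trans[OF sum_UN_le] sum_mono) (auto simp: fin[simplified])
    also have "\<dots> \<le> (\<Sum>p\<in>{m, - m}. \<Sum>i\<in>V. r * Z)"
      by (intro sum_mono dev_le)
    also have "\<dots> = 2 * n * r * Z" using assms(2) by (simp add: n_def)
    finally show "(\<Sum>S\<in>B. spin_weight \<theta> V S)
       \<le> (real (card V ^ card V) * exp (- (\<epsilon> / (2 * K)) * real (card V) * (real (card V) - 1))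
          + 2 * (real (card V))\<^sup>2 * exp (6 * \<theta> - (real (card V) - 1) * (\<theta> * \<delta>\<^sup>2 / 8)))
         * (\<Sum>S\<in>Pow (edges V). spin_weight \<theta> V S)"
      unfolding W_def Z_def r_def a_def n_def by (simp add: power2_eq_square algebra_simps)
  qed
qed

lemma error_eventually_exponential:
  fixes a b c :: real
  assumes "b > 0" "c > 0"
  shows "eventually (\<lambda>n. real (n ^ n) * exp (- c * real n * (real n - 1))
      + 2 * (real n)\<^sup>2 * exp (a - (real n - 1) * b) \<le> exp (- (b / 2) * real n)) sequentially"
proof -
  have "eventually (\<lambda>n::nat. real n powr real n * exp (- c * real n * (real n - 1))
      + 2 * (real n)\<^sup>2 * exp (a - (real n - 1) * b) \<le> exp (- (b / 2) * real n)) sequentially"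
    using assms by real_asymp
  then show ?thesis
    using eventually_gt_at_top[of 0] by eventually_elim (simp add: powr_realpow)
qed

section \<open>From graphs to spin configurations\<close>

definition adjacency :: "nat set set \<Rightarrow> nat \<Rightarrow> nat \<Rightarrow> nat" where
  "adjacency S i j = (if {i, j} \<in> S then 1 else 0)"

lemma bij_betw_adjacency: "bij_betw adjacency (Pow (edges {1..n})) (graphs n)"
proof (rule bij_betw_byWitness[where f' = "\<lambda>x. {e \<in> edges {1..n}. \<exists>i j. e = {i, j} \<and> x i j = 1}"])
  let ?f = "\<lambda>x. {e \<in> edges {1..n}. \<exists>i j. e = {i, j} \<and> x i j = (1::nat)}"
  show "\<forall>S\<in>Pow (edges {1..n}). ?f (adjacency S) = S"
  proof
    fix S assume S: "S \<in> Pow (edges {1..n})"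
    have "\<exists>i j. e = {i, j} \<and> adjacency S i j = 1" if "e \<in> S" for e
    proof -
      have "card e = 2" using S that by (auto simp: edges_def)
      then obtain i j where "e = {i, j}" by (auto simp: card_2_iff)
      then show ?thesis using that by (auto simp: adjacency_def)
    qed
    moreover have "e \<in> S" if "e = {i, j}" "adjacency S i j = 1" for e i j
      using that by (simp add: adjacency_def split: if_splits)
    ultimately show "?f (adjacency S) = S"
      using S by (intro equalityI subsetI) (blast, simp, blast)
  qed
  show "\<forall>x\<in>graphs n. adjacency (?f x) = x"
  proof (intro ballI ext)
    fix x i j assume x: "x \<in> graphs n"
    have sym: "x i j = x j i" for i j using x by (simp add: graphs_def)
    have val: "x i j = 0 \<or> x i j = 1" using x by (simp add: graphs_def)
    have "x i i = 0" "i \<notin> {1..n} \<or> j \<notin> {1..n} \<longrightarrow> x i j = 0"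
      using x unfolding graphs_def by blast+
    then have "x i j = 0" if "\<not> (i \<in> {1..n} \<and> j \<in> {1..n} \<and> i \<noteq> j)"
      using that by (cases "i = j") auto
    then have "{i, j} \<in> edges {1..n}" if "x i j = 1"
      using that by force
    then have "{i, j} \<in> ?f x" if "x i j = 1"
      using that by blast
    moreover have "x i j = 1" if "{i, j} \<in> ?f x"
    proof -
      obtain a b where ab: "{i, j} = {a, b}" "x a b = 1" using \<open>{i, j} \<in> ?f x\<close> by blast
      then have "(a = i \<and> b = j) \<or> (a = j \<and> b = i)" by (auto simp: doubleton_eq_iff)
      then show ?thesis using ab(2) sym[of i j] by auto
    qed
    ultimately show "adjacency (?f x) i j = x i j"
      using val unfolding adjacency_def by presburger
  qed
  show "adjacency ` Pow (edges {1..n}) \<subseteq> graphs n"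
  proof safe
    fix S assume S: "S \<subseteq> edges {1..n}"
    have "adjacency S i j = 0" if "\<not> (i \<in> {1..n} \<and> j \<in> {1..n} \<and> i \<noteq> j)" for i j
    proof -
      have "{i, j} \<notin> edges {1..n}" using that by simp
      then have "{i, j} \<notin> S" using S by blast
      then show ?thesis by (simp add: adjacency_def)
    qed
    moreover have "adjacency S i j = adjacency S j i" "adjacency S i j \<in> {0, 1}" for i j
      by (simp_all add: adjacency_def insert_commute)
    ultimately show "adjacency S \<in> graphs n"
      unfolding graphs_def by blast
  qed
  show "?f ` graphs n \<subseteq> Pow (edges {1..n})" by blast
qed

text \<open>The numbers of edges and of two stars are sums over increasing pairs, whereas degrees and their
  squares expand into sums over all ordered pairs.\<close>

lemma sum_less_pairs:
  fixes h :: "nat \<Rightarrow> nat \<Rightarrow> nat"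
  assumes "finite J" "\<And>j l. h j l = h l j"
  shows "(\<Sum>j\<in>J. \<Sum>l\<in>J - {j}. h j l) = 2 * (\<Sum>(j, l) \<in> {(j, l). j \<in> J \<and> l \<in> J \<and> j < l}. h j l)"
proof -
  let ?P = "{(j, l). j \<in> J \<and> l \<in> J \<and> j < l}" and ?Q = "{(j, l). j \<in> J \<and> l \<in> J \<and> l < j}"
  have fin: "finite ?P" "finite ?Q"
    by (rule finite_subset[of _ "J \<times> J"]; use assms(1) in auto)+
  have "(\<Sum>j\<in>J. \<Sum>l\<in>J - {j}. h j l) = (\<Sum>(j, l)\<in>(SIGMA j:J. J - {j}). h j l)"
    using assms(1) by (intro sum.Sigma) auto
  also have "(SIGMA j:J. J - {j}) = ?P \<union> ?Q" by auto
  also have "(\<Sum>(j, l)\<in>?P \<union> ?Q. h j l) = (\<Sum>(j, l)\<in>?P. h j l) + (\<Sum>(j, l)\<in>?Q. h j l)"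
    by (intro sum.union_disjoint fin) auto
  also have "(\<Sum>(j, l)\<in>?Q. h j l) = (\<Sum>(j, l)\<in>?P. h j l)"
    by (rule sum.reindex_bij_witness[where i = prod.swap and j = prod.swap]) (auto simp: assms(2))
  finally show ?thesis by simp
qed

lemma deg_adjacency:
  assumes "i \<in> {1..n}"
  shows "real (deg n (adjacency S) i) = (spin_degree {1..n} S i + (real n - 1)) / 2"
proof -
  have "spin_degree {1..n} S i = (\<Sum>j\<in>{1..n} - {i}. 2 * real (adjacency S i j) - 1)"
    unfolding spin_degree_def by (intro sum.cong refl) (simp add: spin_def adjacency_def)
  also have "\<dots> = 2 * real (deg n (adjacency S) i) - (real n - 1)"
    using card_others[of "{1..n}" i] assms
    by (simp add: deg_def sum_subtractf sum_distrib_left del: card_Diff_insert card_Diff_singleton)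
  finally show ?thesis by simp
qed

text \<open>The numbers of edges and two stars satisfy \<open>2 * E = (\<Sum>i. d\<^sub>i)\<close> and \<open>2 * T = (\<Sum>i. d\<^sub>i\<^sup>2 - d\<^sub>i)\<close>.
  Completing the square in \<open>d\<^sub>i = (k\<^sub>i + n - 1) / 2\<close> eliminates the linear terms because
  \<open>\<beta>1 = - \<beta>2\<close>.\<close>

lemma two_star_weight_adjacency:
  assumes "n \<ge> 2"
  shows "two_star_weight n (- \<beta>) \<beta> (adjacency S)
       = exp (- \<beta> * real n * (real n - 1) / 8) * spin_weight (\<beta> / 4) {1..n} S"
proof -
  let ?V = "{1..n}" and ?x = "adjacency S"
  define M where "M = real n - 1"
  have M: "M > 0" using assms by (simp add: M_def)
  have sym: "?x i j = ?x j i" for i j by (simp add: adjacency_def insert_commute)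
  have edges: "2 * real (num_edges n ?x) = (\<Sum>i\<in>?V. real (deg n ?x i))"
  proof -
    have "(\<Sum>i\<in>?V. deg n ?x i) = 2 * num_edges n ?x"
      unfolding deg_def num_edges_def by (intro sum_less_pairs sym) simp
    then show ?thesis by (metis of_nat_mult of_nat_numeral of_nat_sum)
  qed
  have stars: "2 * real (num_two_stars n ?x) = (\<Sum>i\<in>?V. (real (deg n ?x i))\<^sup>2 - real (deg n ?x i))"
  proof -
    have "real (2 * (\<Sum>(j, l) \<in> {(j, l). j \<in> ?V - {i} \<and> l \<in> ?V - {i} \<and> j < l}. ?x i j * ?x i l))
        = (real (deg n ?x i))\<^sup>2 - real (deg n ?x i)" for i
    proof -
      let ?J = "?V - {i}"
      have "real (2 * (\<Sum>(j, l) \<in> {(j, l). j \<in> ?J \<and> l \<in> ?J \<and> j < l}. ?x i j * ?x i l))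
          = real (\<Sum>j\<in>?J. \<Sum>l\<in>?J - {j}. ?x i j * ?x i l)"
        by (subst sum_less_pairs) auto
      also have "\<dots> = (\<Sum>j\<in>?J. real (?x i j) * (\<Sum>l\<in>?J - {j}. real (?x i l)))"
        by (simp add: sum_distrib_left)
      also have "\<dots> = (\<Sum>j\<in>?J. real (?x i j) * real (deg n ?x i) - real (?x i j))"
      proof (intro sum.cong refl)
        fix j assume "j \<in> ?J"
        then have "(\<Sum>l\<in>?J - {j}. real (?x i l)) = real (deg n ?x i) - real (?x i j)"
          unfolding deg_def of_nat_sum by (subst sum_diff1) auto
        moreover have "real (?x i j) * real (?x i j) = real (?x i j)" by (simp add: adjacency_def)
        ultimately show "real (?x i j) * (\<Sum>l\<in>?J - {j}. real (?x i l))
            = real (?x i j) * real (deg n ?x i) - real (?x i j)" by (simp add: right_diff_distrib)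
      qed
      also have "\<dots> = (real (deg n ?x i))\<^sup>2 - real (deg n ?x i)"
        by (simp add: deg_def sum_subtractf sum_distrib_right power2_eq_square)
      finally show ?thesis .
    qed
    then show ?thesis
      unfolding num_two_stars_def of_nat_sum by (simp add: sum_distrib_left)
  qed
  have "\<beta> / M * real (num_two_stars n ?x) + (- \<beta> + \<beta> / M) * real (num_edges n ?x)
      = \<beta> / (2 * M) * (2 * real (num_two_stars n ?x)) + (\<beta> / (2 * M) - \<beta> / 2) * (2 * real (num_edges n ?x))"
    using M by (simp add: field_simps)
  also have "\<dots> = (\<Sum>i\<in>?V. \<beta> / (2 * M) * (real (deg n ?x i))\<^sup>2 - \<beta> / 2 * real (deg n ?x i))"
    unfolding stars edges by (simp add: sum_distrib_left sum_subtractf algebra_simps)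
  also have "\<dots> = (\<Sum>i\<in>?V. \<beta> / 4 / (2 * M) * (spin_degree ?V S i)\<^sup>2 - \<beta> * M / 8)"
    using M by (intro sum.cong refl) (simp add: deg_adjacency field_simps power2_eq_square flip: M_def)
  also have "\<dots> = - \<beta> * real n * M / 8 + \<beta> / 4 / (2 * M) * (\<Sum>i\<in>?V. (spin_degree ?V S i)\<^sup>2)"
    by (simp add: sum_subtractf sum_distrib_left)
  finally show ?thesis
    unfolding two_star_weight_def spin_weight_def by (simp add: M_def exp_add[symmetric])
qed

lemma prob_two_star_pmf:
  assumes "n \<ge> 2"
  shows "measure_pmf.prob (two_star_pmf n (- \<beta>) \<beta>) A
       = (\<Sum>S | S \<in> Pow (edges {1..n}) \<and> adjacency S \<in> A. spin_weight (\<beta> / 4) {1..n} S)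
         / (\<Sum>S\<in>Pow (edges {1..n}). spin_weight (\<beta> / 4) {1..n} S)"
proof -
  let ?E = "edges {1..n}" and ?W = "spin_weight (\<beta> / 4) {1..n}"
  define c where "c = exp (- \<beta> * real n * (real n - 1) / 8)"
  have bij: "bij_betw adjacency {S. S \<in> Pow ?E \<and> adjacency S \<in> A} (A \<inter> graphs n)" for A
    using bij_betw_adjacency[of n] by (auto simp: bij_betw_def inj_on_def)
  have sum: "(\<Sum>x\<in>A \<inter> graphs n. two_star_weight n (- \<beta>) \<beta> x)
      = c * (\<Sum>S | S \<in> Pow ?E \<and> adjacency S \<in> A. ?W S)" for A
    unfolding sum.reindex_bij_betw[OF bij, symmetric] c_def
    by (simp add: two_star_weight_adjacency[OF assms] sum_distrib_left)
  have "measure_pmf.prob (two_star_pmf n (- \<beta>) \<beta>) A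
      = measure_pmf.prob (two_star_pmf n (- \<beta>) \<beta>) (A \<inter> graphs n)"
    by (intro measure_prob_cong_0) (auto simp: pmf_two_star_pmf)
  also have "\<dots> = (\<Sum>x\<in>A \<inter> graphs n. two_star_weight n (- \<beta>) \<beta> x) / two_star_Z n (- \<beta>) \<beta>"
    using finite_graphs[of n]
    by (simp add: measure_measure_pmf_finite pmf_two_star_pmf sum_divide_distrib)
  also have "two_star_Z n (- \<beta>) \<beta> = c * (\<Sum>S\<in>Pow ?E. ?W S)"
    unfolding two_star_Z_def using sum[of UNIV] by (simp add: Pow_def)
  finally show ?thesis by (simp add: sum c_def)
qed

section \<open>Two phases of equal probability\<close>

text \<open>Graphs near the phase \<open>- p\<close> deviate from \<open>p\<close>, and graphs near \<open>p\<close> do not. Complementation gives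
  both classes the same weight, so the weight of the deviating graphs lies within that of the
  graphs near no phase from \<open>Z / 2\<close>. The tolerance \<open>min (2 * \<delta>) (m - \<delta>)\<close> keeps the classes on the
  right sides of the threshold \<open>2 * \<delta>\<close>; it needs \<open>\<delta> < m\<close>, where \<open>m\<close> is the difference of the two
  edge densities.\<close>

lemma two_phase_probability:
  fixes \<theta> m p \<delta> :: real
  assumes "finite V" "0 < m" "p \<in> {m, - m}" "0 < \<delta>" "\<delta> < m"
  defines "Z \<equiv> (\<Sum>S\<in>Pow (edges V). spin_weight \<theta> V S)"
  assumes bad: "(\<Sum>S | S \<in> Pow (edges V) \<and>
      (\<forall>p\<in>{m, - m}. \<exists>i\<in>V. \<bar>scaled_degree V S i - p\<bar> > min (2 * \<delta>) (m - \<delta>)). spin_weight \<theta> V S) \<le> \<epsilon> * Z"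
    and "V \<noteq> {}"
  shows "\<bar>(\<Sum>S | S \<in> Pow (edges V) \<and> (\<exists>i\<in>V. \<bar>scaled_degree V S i - p\<bar> > 2 * \<delta>). spin_weight \<theta> V S) / Z - 1 / 2\<bar> \<le> \<epsilon>"
proof -
  let ?E = "edges V" and ?W = "spin_weight \<theta> V"
  define near where "near q S = (\<forall>i\<in>V. \<bar>scaled_degree V S i - q\<bar> \<le> min (2 * \<delta>) (m - \<delta>))" for q S
  define A where "A = {S. S \<in> Pow ?E \<and> (\<exists>i\<in>V. \<bar>scaled_degree V S i - p\<bar> > 2 * \<delta>)}"
  define N where "N q = {S. S \<in> Pow ?E \<and> near q S}" for q
  define B where "B = {S. S \<in> Pow ?E \<and> (\<forall>p\<in>{m, - m}. \<not> near p S)}"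
  have fin: "finite (Pow ?E)" using assms(1) by (simp add: finite_edges)
  have Wpos: "0 < ?W S" for S by (simp add: spin_weight_def)
  have Z: "Z > 0" unfolding Z_def using fin Wpos by (intro sum_pos) auto
  have B: "sum ?W B \<le> \<epsilon> * Z" "sum ?W B \<ge> 0"
  proof -
    have "B = {S. S \<in> Pow ?E \<and> (\<forall>p\<in>{m, - m}. \<exists>i\<in>V. \<bar>scaled_degree V S i - p\<bar> > min (2 * \<delta>) (m - \<delta>))}"
      unfolding B_def near_def by (intro Collect_cong conj_cong ball_cong refl) (meson not_le)
    then show "sum ?W B \<le> \<epsilon> * Z" using bad by simp
    show "sum ?W B \<ge> 0" by (simp add: sum_nonneg Wpos less_imp_le)
  qed
  obtain i where i: "i \<in> V" using assms by blast
  \<comment> \<open>Complementing the graph exchanges the two phases.\<close>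
  have sym: "sum ?W (N (- p)) = sum ?W (N p)"
  proof (rule sum.reindex_bij_witness[where i = "\<lambda>S. ?E - S" and j = "\<lambda>S. ?E - S"])
    have flip: "near (- q) (?E - S) = near q S" for q S
      unfolding near_def
      by (intro ball_cong refl) (simp add: scaled_degree_def spin_degree_complement abs_minus_commute)
    show "S \<in> N (- p) \<Longrightarrow> ?E - S \<in> N p" "S \<in> N p \<Longrightarrow> ?E - S \<in> N (- p)" for S
      using flip[of p S] flip[of "- p" S] by (auto simp: N_def)
  qed (auto simp: N_def spin_weight_complement)
  have disj: "N p \<inter> N (- p) = {}"
  proof -
    have False if "near p S" "near (- p) S" for S
      using that i assms unfolding near_def by (auto dest!: bspec)
    then show ?thesis by (auto simp: N_def)
  qed
  have far: "N (- p) \<subseteq> A"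
  proof
    fix S assume S: "S \<in> N (- p)"
    then have "\<bar>scaled_degree V S i + p\<bar> \<le> m - \<delta>" using i by (auto simp: N_def near_def)
    then have "\<bar>scaled_degree V S i - p\<bar> > 2 * \<delta>" using assms by auto
    then show "S \<in> A" using S i by (auto simp: A_def N_def)
  qed
  have AN: "A \<inter> N p = {}" by (force simp: A_def N_def near_def)
  have cover: "Pow ?E = (N p \<union> N (- p)) \<union> B" "(N p \<union> N (- p)) \<inter> B = {}"
    using assms(3) by (auto simp: N_def B_def)
  have subs: "A \<subseteq> Pow ?E" "N q \<subseteq> Pow ?E" "B \<subseteq> Pow ?E" for q by (auto simp: A_def N_def B_def)
  note fins = finite_subset[OF _ fin, OF subs(1)] finite_subset[OF _ fin, OF subs(2)] finite_subset[OF _ fin, OF subs(3)]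
  have "Z = 2 * sum ?W (N p) + sum ?W B"
    unfolding Z_def cover(1) using cover(2) disj fins sym by (simp add: sum.union_disjoint)
  moreover have "sum ?W (N p) \<le> sum ?W A"
    unfolding sym[symmetric] using far fins Wpos by (intro sum_mono2) (auto intro: less_imp_le)
  moreover have "sum ?W A + sum ?W (N p) \<le> Z"
    unfolding Z_def sum.union_disjoint[OF fins(1) fins(2) AN, symmetric]
    using fin subs Wpos by (intro sum_mono2) (auto intro: less_imp_le)
  ultimately have "\<bar>sum ?W A - Z / 2\<bar> \<le> \<epsilon> * Z" using B by linarith
  then have "\<bar>sum ?W A - Z / 2\<bar> / Z \<le> \<epsilon>" using Z by (simp add: field_simps)
  also have "\<bar>sum ?W A - Z / 2\<bar> / Z = \<bar>sum ?W A / Z - 1 / 2\<bar>"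
  proof -
    have "sum ?W A / Z - 1 / 2 = (sum ?W A - Z / 2) / Z" using Z by (simp add: field_simps)
    then show ?thesis using Z by (simp add: abs_divide)
  qed
  finally show ?thesis unfolding A_def .
qed

theorem theorem4p3:
  fixes \<beta>1 \<beta>2 \<theta>1 \<theta>2 :: real
  assumes "\<beta>2 > 0"
    and "\<theta>2 = \<beta>2 / 4"
    and "\<theta>1 = (\<beta>1 + \<beta>2) / 2"
    and "(\<theta>1, \<theta>2) \<in> Theta2"
  shows "\<exists>p1 p2 :: real. p1 \<in> {0<..<1} \<and> p2 \<in> {0<..<1} \<and> p1 \<noteq> p2 \<and>
    (\<forall>\<delta>. 0 < \<delta> \<and> \<delta> < \<bar>p1 - p2\<bar> \<longrightarrow> (\<forall>p \<in> {p1, p2}. \<exists>C>0. \<forall>n\<ge>2.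
       \<bar>measure_pmf.prob (two_star_pmf n \<beta>1 \<beta>2)
           {x. Max ((\<lambda>i. \<bar>real (deg n x i) / (real n - 1) - p\<bar>) ` {1..n}) > \<delta>} - 1 / 2\<bar>
         \<le> exp (- C * real n)))"
proof -
  have \<theta>: "\<theta>2 > 1 / 2" and \<beta>: "\<beta>1 = - \<beta>2" using assms by (auto simp: Theta2_def)
  then have "\<theta>2 > 0" by simp
  obtain m where m: "0 < m" "m < 1"
    "\<And>u. u \<noteq> m \<Longrightarrow> u \<noteq> - m \<Longrightarrow> pair_energy \<theta>2 m m < pair_energy \<theta>2 u u"
    using diagonal_energy_minimum[OF \<theta>] by metis
  show ?thesis
  proof (rule exI[of _ "(1 + m) / 2"], rule exI[of _ "(1 - m) / 2"], intro conjI allI impI ballI)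
    show "(1 + m) / 2 \<in> {0<..<1}" "(1 - m) / 2 \<in> {0<..<1}" "(1 + m) / 2 \<noteq> (1 - m) / 2"
      using m by auto
  next
    fix \<delta> p assume "0 < \<delta> \<and> \<delta> < \<bar>(1 + m) / 2 - (1 - m) / 2\<bar>"
    then have \<delta>: "0 < \<delta>" "\<delta> < m" using m by (auto simp: field_simps)
    assume "p \<in> {(1 + m) / 2, (1 - m) / 2}"
    then have p: "2 * p - 1 \<in> {m, - m}" by auto
    define \<delta>' where "\<delta>' = min (2 * \<delta>) (m - \<delta>)"
    have \<delta>': "\<delta>' > 0" using \<delta> by (simp add: \<delta>'_def)
    define P where "P n = measure_pmf.prob (two_star_pmf n \<beta>1 \<beta>2)
        {x. Max ((\<lambda>i. \<bar>real (deg n x i) / (real n - 1) - p\<bar>) ` {1..n}) > \<delta>}" for n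
    have P: "P n = (\<Sum>S | S \<in> Pow (edges {1..n}) \<and> (\<exists>i\<in>{1..n}. \<bar>scaled_degree {1..n} S i - (2 * p - 1)\<bar> > 2 * \<delta>).
          spin_weight \<theta>2 {1..n} S) / (\<Sum>S\<in>Pow (edges {1..n}). spin_weight \<theta>2 {1..n} S)" if "n \<ge> 2" for n
    proof -
      have "(\<delta> < Max ((\<lambda>i. \<bar>real (deg n (adjacency S) i) / (real n - 1) - p\<bar>) ` {1..n}))
          = (\<exists>i\<in>{1..n}. \<bar>scaled_degree {1..n} S i - (2 * p - 1)\<bar> > 2 * \<delta>)" for S
      proof -
        have "real (deg n (adjacency S) i) / (real n - 1) - p = (scaled_degree {1..n} S i - (2 * p - 1)) / 2"
          if "i \<in> {1..n}" for i
          using \<open>n \<ge> 2\<close> that by (simp add: deg_adjacency scaled_degree_def field_simps)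
        then have "(\<delta> < \<bar>real (deg n (adjacency S) i) / (real n - 1) - p\<bar>)
            = (\<bar>scaled_degree {1..n} S i - (2 * p - 1)\<bar> > 2 * \<delta>)" if "i \<in> {1..n}" for i
          using that by (simp only:) (simp add: field_simps)
        then show ?thesis using \<open>n \<ge> 2\<close> by (subst Max_gr_iff) auto
      qed
      then show ?thesis
        unfolding P_def \<beta> prob_two_star_pmf[OF that] assms(2)[symmetric] by simp
    qed
    obtain c where c: "c > 0" and
      bad: "\<And>V :: nat set. finite V \<Longrightarrow> card V \<ge> 2 \<Longrightarrow>
       (\<Sum>S | S \<in> Pow (edges V) \<and> (\<forall>p\<in>{m, - m}. \<exists>i\<in>V. \<bar>scaled_degree V S i - p\<bar> > \<delta>'). spin_weight \<theta>2 V S)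
       \<le> (real (card V ^ card V) * exp (- c * real (card V) * (real (card V) - 1))
          + 2 * (real (card V))\<^sup>2 * exp (6 * \<theta>2 - (real (card V) - 1) * (\<theta>2 * \<delta>'\<^sup>2 / 8)))
         * (\<Sum>S\<in>Pow (edges V). spin_weight \<theta>2 V S)"
      using no_phase_weight[OF \<open>\<theta>2 > 0\<close> m(1,2) \<delta>' m(3), where 'a = nat] by blast
    define \<epsilon> where "\<epsilon> n = real (n ^ n) * exp (- c * real n * (real n - 1))
          + 2 * (real n)\<^sup>2 * exp (6 * \<theta>2 - (real n - 1) * (\<theta>2 * \<delta>'\<^sup>2 / 8))" for n
    define b where "b = \<theta>2 * \<delta>'\<^sup>2 / 8"
    have b: "b > 0" using \<open>\<theta>2 > 0\<close> \<delta>' by (simp add: b_def)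
    have P_\<epsilon>: "\<bar>P n - 1 / 2\<bar> \<le> \<epsilon> n" if "n \<ge> 2" for n
      unfolding P[OF that]
      by (rule two_phase_probability[OF _ m(1) p \<delta>])
         (use bad[of "{1..n}"] that in \<open>simp_all add: \<epsilon>_def \<delta>'_def\<close>)
    obtain N where N: "\<And>n. n \<ge> N \<Longrightarrow> \<epsilon> n \<le> exp (- (b / 2) * real n)"
      using error_eventually_exponential[OF b c, of "6 * \<theta>2"]
      unfolding \<epsilon>_def b_def eventually_sequentially by blast
    \<comment> \<open>Below the threshold the trivial bound \<open>1 / 2\<close> suffices, once the rate is at most
        \<open>ln 2 / (N + 1)\<close>.\<close>
    define C where "C = min (b / 2) (ln 2 / real (Suc N))"
    have "\<exists>C>0. \<forall>n\<ge>2. \<bar>P n - 1 / 2\<bar> \<le> exp (- C * real n)"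
    proof (intro exI[of _ C] conjI allI impI)
      show "C > 0" using b by (simp add: C_def)
      fix n :: nat assume n: "n \<ge> 2"
      show "\<bar>P n - 1 / 2\<bar> \<le> exp (- C * real n)"
      proof (cases "n \<ge> N")
        case True
        have "C * real n \<le> b / 2 * real n"
          unfolding C_def by (intro mult_right_mono min.cobounded1) simp
        then have "exp (- (b / 2) * real n) \<le> exp (- C * real n)" by simp
        then show ?thesis using P_\<epsilon>[OF n] N[OF True] by linarith
      next
        case False
        have "C * real n \<le> ln 2 / real (Suc N) * real (Suc N)"
          using False unfolding C_def by (intro mult_mono min.cobounded2) auto
        then have "exp (- ln 2) \<le> exp (- C * real n)" by simp
        then have "1 / 2 \<le> exp (- C * real n)" by (simp add: exp_minus)
        moreover have "0 \<le> P n" "P n \<le> 1" unfolding P_def by auto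
        ultimately show ?thesis by (auto simp: abs_le_iff)
      qed
    qed
    then show "\<exists>C>0. \<forall>n\<ge>2.
       \<bar>measure_pmf.prob (two_star_pmf n \<beta>1 \<beta>2)
           {x. Max ((\<lambda>i. \<bar>real (deg n x i) / (real n - 1) - p\<bar>) ` {1..n}) > \<delta>} - 1 / 2\<bar>
         \<le> exp (- C * real n)"
      unfolding P_def .
  qed
qed

end
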